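(* Let $d\ge 1$ and $0<\alpha<d$. Let $P \in \mathbb{Z}[X_1,\ldots,X_d]$ be a non-singular polynomial of degree at least $2$; that is, if $k = \deg P \geq 2$ and $P_k$ is the homogeneous part of $P$ of degree $k$, then $\nabla P_k(x) \neq 0$ for all $x \in \mathbb{C}^d\setminus\{0\}$. Let $s_P(\mathbb{T}^d,\alpha)$ be the infimum of all $s\in\mathbb{R}$ for which the fractal maximal estimate $$\Big\lVert \sup_{t>0} |e^{itP(D)}f| \Big\rVert_{L^2(\mathbb{T}^d, d\mu)} \lesssim \lVert f\rVert_{H^s(\mathbb{T}^d)}, \qquad \forall f \in H^s(\mathbb{T}^d), \quad \forall \mu\in\mathcal{M}_\alpha,$$ holds. Then $$s_P(\mathbb{T}^d,\alpha) \ge \frac{d}{2(d+1)}\,(d+1-\alpha).$$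
   Context: $\mathbb{T}^d = \mathbb{R}^d/\mathbb{Z}^d$. For a function $f$ on $\mathbb{T}^d$ with Fourier coefficients $\widehat f_n$, $n\in\mathbb{Z}^d$, so that $f(x) = \sum_{n} \widehat f_n e^{2\pi i n\cdot x}$, the solution operator of $i\partial_t u + P(D)u = 0$, $u(x,0)=f(x)$, is $$e^{itP(D)}f(x) = \sum_{n\in\mathbb{Z}^d} \widehat f_n\, e^{2\pi i (n\cdot x + P(n)t)}.$$ The Sobolev norm is $\lVert f\rVert_{H^s}^2 = \sum_{n\in\mathbb{Z}^d} (1+|n|^2)^s |\widehat f_n|^2$. $\mathcal{M}_\alpha$ is the set of $\alpha$-Frostman measures on $\mathbb{T}^d$, i.e. (positive) Borel measures $\mu$ for which there is a constant $C_\mu$ with $\mu(B_r)\le C_\mu r^\alpha$ for every $r<1$ and every ball $B_r$ of radius $r$. The symbol $\lesssim$ in the fractal maximal estimate means inequality up to a constant independent of $f$ and depending on $\mu$ only through its Frostman constant $C_\mu$ (it may also depend on $d,P,s,\alpha$). As usual, the estimate is understood in the a priori sense, i.e. it is tested on those $f$ having only finitely many nonzero Fourier coefficients, so that $e^{itP(D)}f(x)$ is defined for every $x$ and $t$. *)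

theory Defs
  imports "HOL-Analysis.Analysis" "HOL-Library.Poly_Mapping"
begin

section \<open>The torus\<close>

definition of_int_vec :: "int ^ 'n \<Rightarrow> 'a::ring_1 ^ 'n" where
  "of_int_vec n = (\<chi> i. of_int (n $ i))"

definition int_lattice :: "(real ^ 'n) set" where
  "int_lattice = range of_int_vec"

lemma int_lattice_iff: "x \<in> int_lattice \<longleftrightarrow> (\<forall>i. x $ i \<in> \<int>)"
proof
  assume "x \<in> int_lattice"
  then show "\<forall>i. x $ i \<in> \<int>"
    by (auto simp: int_lattice_def of_int_vec_def)
next
  assume "\<forall>i. x $ i \<in> \<int>"
  then have "x = of_int_vec (\<chi> i. \<lfloor>x $ i\<rfloor>)"
    by (simp add: of_int_vec_def vec_eq_iff)
  then show "x \<in> int_lattice"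
    unfolding int_lattice_def by blast
qed

lemma int_lattice_zero: "0 \<in> int_lattice"
  by (simp add: int_lattice_iff)

lemma int_lattice_add: "x \<in> int_lattice \<Longrightarrow> y \<in> int_lattice \<Longrightarrow> x + y \<in> int_lattice"
  by (simp add: int_lattice_iff)

lemma int_lattice_minus: "x \<in> int_lattice \<Longrightarrow> - x \<in> int_lattice"
  by (simp add: int_lattice_iff)

lemma int_lattice_diff: "x \<in> int_lattice \<Longrightarrow> y \<in> int_lattice \<Longrightarrow> x - y \<in> int_lattice"
  by (simp add: int_lattice_iff)

lemma closed_int_lattice: "closed (int_lattice :: (real ^ 'n) set)"
proof -
  have eq: "int_lattice = (\<Inter>i. (\<lambda>x :: real ^ 'n. x $ i) -` \<int>)"
    by (auto simp: int_lattice_iff)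
  have "closed ((\<lambda>x :: real ^ 'n. x $ i) -` \<int>)" for i
    by (intro closed_vimage closed_Ints continuous_intros)
  then show ?thesis
    unfolding eq by blast
qed

definition torus_rel :: "real ^ 'n \<Rightarrow> real ^ 'n \<Rightarrow> bool" where
  "torus_rel x y \<longleftrightarrow> x - y \<in> int_lattice"

quotient_type 'n torus = "real ^ 'n" / torus_rel
  morphisms rep_torus torus_proj
proof (rule equivpI)
  show "reflp torus_rel"
    by (simp add: reflp_def torus_rel_def int_lattice_zero)
  show "symp torus_rel"
    unfolding symp_def torus_rel_def by (metis int_lattice_minus minus_diff_eq)
  show "transp torus_rel"
    unfolding transp_def torus_rel_def by (metis int_lattice_add diff_add_cancel add_diff_eq)
qed

lemma infdist_lattice_shift:
  assumes "z \<in> int_lattice"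
  shows "infdist (x + z) int_lattice = infdist x int_lattice"
proof -
  have le: "infdist (y + w) int_lattice \<le> infdist y int_lattice"
    if w: "w \<in> int_lattice" for y w :: "real ^ 'n"
  proof -
    have "infdist (y + w) int_lattice \<le> dist y a" if a: "a \<in> int_lattice" for a
      using infdist_le[OF int_lattice_add[OF a w], of "y + w"] by (simp add: dist_norm)
    then show ?thesis
      using int_lattice_zero
      by (subst (2) infdist_notempty) (auto intro!: cINF_greatest)
  qed
  show ?thesis
    using le[OF assms, of x] le[OF int_lattice_minus[OF assms], of "x + z"] by simp
qed

lemma infdist_lattice_uminus:
  "infdist (- x) int_lattice = infdist (x :: real ^ 'n) int_lattice"
proof -
  have le: "infdist (- y) int_lattice \<le> infdist y int_lattice" for y :: "real ^ 'n"
  proof -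
    have "infdist (- y) int_lattice \<le> dist y a" if a: "a \<in> int_lattice" for a
      using infdist_le[OF int_lattice_minus[OF a], of "- y"]
      by (simp add: dist_norm norm_minus_commute)
    then show ?thesis
      using int_lattice_zero
      by (subst (2) infdist_notempty) (auto intro!: cINF_greatest)
  qed
  show ?thesis
    using le[of x] le[of "- x"] by simp
qed

lemma infdist_lattice_add:
  "infdist (x + y) int_lattice \<le> infdist x int_lattice + infdist (y :: real ^ 'n) int_lattice"
proof -
  have "infdist (x + y) int_lattice - infdist y int_lattice \<le> dist x a"
    if a: "a \<in> int_lattice" for a
  proof -
    have "infdist (x + y) int_lattice \<le> infdist (y + a) int_lattice + dist (x + y) (y + a)"
      by (rule infdist_triangle)
    then show ?thesis
      by (simp add: infdist_lattice_shift[OF a] dist_norm)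
  qed
  then have "infdist (x + y) int_lattice - infdist y int_lattice \<le> infdist x int_lattice"
    using int_lattice_zero
    by (subst (3) infdist_notempty) (auto intro!: cINF_greatest)
  then show ?thesis by simp
qed

text \<open>
  The torus carries the quotient distance
  \<open>dist [x] [y] = inf {|x - y - m| : m \<in> \<int>\<^sup>d}\<close>; its balls are the balls in the
  Frostman condition, and \<open>borel\<close> is taken with respect to its topology.
\<close>

instantiation torus :: (finite) metric_space
begin

lift_definition dist_torus :: "'a torus \<Rightarrow> 'a torus \<Rightarrow> real"
  is "\<lambda>x y. infdist (x - y) int_lattice"
proof -
  fix x x' y y' :: "real ^ 'a"
  assume "torus_rel x x'" "torus_rel y y'"
  then have "(x - x') - (y - y') \<in> int_lattice"
    by (simp add: torus_rel_def int_lattice_diff)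
  from infdist_lattice_shift[OF this, of "x' - y'"]
  show "infdist (x - y) int_lattice = infdist (x' - y') int_lattice"
    by (simp add: algebra_simps)
qed

definition uniformity_torus :: "('a torus \<times> 'a torus) filter" where
  "uniformity_torus = (INF e\<in>{0<..}. principal {(x, y). dist x y < e})"

definition open_torus :: "'a torus set \<Rightarrow> bool" where
  "open_torus U \<longleftrightarrow> (\<forall>x\<in>U. \<forall>\<^sub>F (x', y) in uniformity. x' = x \<longrightarrow> y \<in> U)"

instance
proof
  show "dist x y = 0 \<longleftrightarrow> x = y" for x y :: "'a torus"
  proof transfer
    fix x y :: "real ^ 'a"
    show "infdist (x - y) int_lattice = 0 \<longleftrightarrow> torus_rel x y"
      using in_closed_iff_infdist_zero[OF closed_int_lattice, of "x - y"] int_lattice_zero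
      by (auto simp: torus_rel_def)
  qed
  show "dist x y \<le> dist x z + dist y z" for x y z :: "'a torus"
  proof transfer
    fix x y z :: "real ^ 'a"
    show "infdist (x - y) int_lattice
        \<le> infdist (x - z) int_lattice + infdist (y - z) int_lattice"
      using infdist_lattice_add[of "x - z" "z - y"] infdist_lattice_uminus[of "y - z"] by simp
  qed
qed (simp_all add: uniformity_torus_def open_torus_def)

end


section \<open>Fourier series\<close>

lift_definition character :: "int ^ 'n \<Rightarrow> 'n::finite torus \<Rightarrow> complex"
  is "\<lambda>n x. exp (2 * pi * \<i> * of_real (of_int_vec n \<bullet> x))"
proof -
  fix n :: "int ^ 'n" and x y :: "real ^ 'n"
  assume "torus_rel x y"
  then have "of_int_vec n \<bullet> (x - y) \<in> \<int>"
    by (auto simp: torus_rel_def int_lattice_iff inner_vec_def of_int_vec_def intro!: Ints_sum)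
  then obtain m where "of_int_vec n \<bullet> x = of_int_vec n \<bullet> y + of_int m"
    by (auto simp: inner_diff_right elim!: Ints_cases) (metis diff_add_cancel add.commute)
  then have "2 * pi * \<i> * of_real (of_int_vec n \<bullet> x)
      = 2 * pi * \<i> * of_real (of_int_vec n \<bullet> y) + 2 * of_int m * of_real pi * \<i>"
    by (simp add: algebra_simps)
  then show "exp (2 * pi * \<i> * of_real (of_int_vec n \<bullet> x))
      = exp (2 * pi * \<i> * of_real (of_int_vec n \<bullet> y))"
    by (subst exp_eq) auto
qed

definition fourier_coeff :: "('n::finite torus \<Rightarrow> complex) \<Rightarrow> int ^ 'n \<Rightarrow> complex" where
  "fourier_coeff f n =
     (LINT x : cbox 0 1 | lborel. f (torus_proj x) * cnj (character n (torus_proj x)))"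

definition trig_polynomial :: "('n::finite torus \<Rightarrow> complex) \<Rightarrow> bool" where
  "trig_polynomial f \<longleftrightarrow>
     finite {n. fourier_coeff f n \<noteq> 0} \<and>
     (\<forall>x. f x = (\<Sum>\<^sub>\<infinity>n. fourier_coeff f n * character n x))"

definition sobolev_norm :: "real \<Rightarrow> ('n::finite torus \<Rightarrow> complex) \<Rightarrow> real" where
  "sobolev_norm s f =
     sqrt (\<Sum>\<^sub>\<infinity>n. (1 + (norm (of_int_vec n :: real ^ 'n))\<^sup>2) powr s
                   * (cmod (fourier_coeff f n))\<^sup>2)"


section \<open>Integer polynomials in several variables\<close>

text \<open>
  A polynomial in \<open>\<int>[X\<^sub>i : i \<in> 'n]\<close> maps each exponent vector to its coefficient;
  addition and multiplication of the type \<open>_ \<Rightarrow>\<^sub>0 _\<close> are those of the polynomial ring.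
\<close>

type_synonym 'n int_mpoly = "('n \<Rightarrow>\<^sub>0 nat) \<Rightarrow>\<^sub>0 int"

definition monom_degree :: "('n::finite \<Rightarrow>\<^sub>0 nat) \<Rightarrow> nat" where
  "monom_degree m = (\<Sum>i\<in>UNIV. Poly_Mapping.lookup m i)"

definition mpoly_eval :: "'n::finite int_mpoly \<Rightarrow> 'a::comm_ring_1 ^ 'n \<Rightarrow> 'a" where
  "mpoly_eval P x =
     (\<Sum>m\<in>Poly_Mapping.keys P. of_int (Poly_Mapping.lookup P m)
        * (\<Prod>i\<in>UNIV. (x $ i) ^ Poly_Mapping.lookup m i))"

text \<open>The zero polynomial gets degree \<open>0\<close>.\<close>

definition mpoly_degree :: "'n::finite int_mpoly \<Rightarrow> nat" where
  "mpoly_degree P = Max (insert 0 (monom_degree ` Poly_Mapping.keys P))"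

definition homogeneous_part :: "nat \<Rightarrow> 'n::finite int_mpoly \<Rightarrow> 'n int_mpoly" where
  "homogeneous_part k P =
     (\<Sum>m\<in>{m \<in> Poly_Mapping.keys P. monom_degree m = k}.
        Poly_Mapping.single m (Poly_Mapping.lookup P m))"

definition mpoly_pderiv :: "'n::finite \<Rightarrow> 'n int_mpoly \<Rightarrow> 'n int_mpoly" where
  "mpoly_pderiv i P =
     (\<Sum>m\<in>Poly_Mapping.keys P.
        Poly_Mapping.single (m - Poly_Mapping.single i 1)
          (int (Poly_Mapping.lookup m i) * Poly_Mapping.lookup P m))"

definition mpoly_gradient :: "'n::finite int_mpoly \<Rightarrow> 'a::comm_ring_1 ^ 'n \<Rightarrow> 'a ^ 'n" where
  "mpoly_gradient P x = (\<chi> i. mpoly_eval (mpoly_pderiv i P) x)"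

definition nonsingular :: "'n::finite int_mpoly \<Rightarrow> bool" where
  "nonsingular P \<longleftrightarrow>
     (\<forall>x :: complex ^ 'n. x \<noteq> 0 \<longrightarrow> mpoly_gradient (homogeneous_part (mpoly_degree P) P) x \<noteq> 0)"


section \<open>The fractal maximal estimate\<close>

text \<open>\<open>propagator P t f\<close> is \<open>e\<^sup>i\<^sup>t\<^sup>P\<^sup>(\<^sup>D\<^sup>) f\<close>.\<close>

definition propagator ::
    "'n::finite int_mpoly \<Rightarrow> real \<Rightarrow> ('n torus \<Rightarrow> complex) \<Rightarrow> 'n torus \<Rightarrow> complex" where
  "propagator P t f x =
     (\<Sum>\<^sub>\<infinity>n. fourier_coeff f n
            * (character n x * exp (2 * pi * \<i> * of_real (of_int (mpoly_eval P n) * t))))"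

definition maximal_function ::
    "'n::finite int_mpoly \<Rightarrow> ('n torus \<Rightarrow> complex) \<Rightarrow> 'n torus \<Rightarrow> ennreal" where
  "maximal_function P f x = (SUP t\<in>{0<..}. ennreal (cmod (propagator P t f x)))"

definition L2_norm :: "'a measure \<Rightarrow> ('a \<Rightarrow> ennreal) \<Rightarrow> ennreal" where
  "L2_norm M g =
     (let I = (\<integral>\<^sup>+x. (g x)\<^sup>2 \<partial>M) in if I = \<infinity> then \<infinity> else ennreal (sqrt (enn2real I)))"

definition frostman :: "real \<Rightarrow> real \<Rightarrow> 'n::finite torus measure \<Rightarrow> bool" where
  "frostman \<alpha> C \<mu> \<longleftrightarrow>
     sets \<mu> = sets borel \<and>
     (\<forall>x r. 0 < r \<and> r < 1 \<longrightarrow> emeasure \<mu> (ball x r) \<le> ennreal (C * r powr \<alpha>))"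

text \<open>
  The constant \<open>K\<close> is chosen after \<open>C\<close> but before \<open>\<mu>\<close> and \<open>f\<close>: it depends on \<open>\<mu>\<close> only
  through its Frostman constant. The estimate is the a priori one, on trigonometric
  polynomials \<open>f\<close>; these belong to every \<open>H\<^sup>s\<close>.
\<close>

definition fractal_maximal_estimate :: "'n::finite int_mpoly \<Rightarrow> real \<Rightarrow> real \<Rightarrow> bool" where
  "fractal_maximal_estimate P \<alpha> s \<longleftrightarrow>
     (\<forall>C. \<exists>K. \<forall>(\<mu> :: 'n torus measure) f. frostman \<alpha> C \<mu> \<longrightarrow> trig_polynomial f \<longrightarrow>
        L2_norm \<mu> (maximal_function P f) \<le> ennreal (K * sobolev_norm s f))"

text \<open>The infimum is taken in \<open>ereal\<close>, where the infimum of the empty set is \<open>\<infinity>\<close>.\<close>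

definition critical_exponent :: "'n::finite int_mpoly \<Rightarrow> real \<Rightarrow> ereal" where
  "critical_exponent P \<alpha> = (INF s\<in>{s :: real. fractal_maximal_estimate P \<alpha> s}. ereal s)"

end

theory Submission
  imports Defs "HOL-Computational_Algebra.Polynomial" "HOL-Computational_Algebra.Primes"
begin

text \<open>
  The lower bound comes from a solution that refocuses at many points. Let \<open>p\<close> be a large prime,
  \<open>a\<close> an integer vector with entries in \<open>{0..<p}\<close>, and \<open>v = \<nabla>P(a)\<close>. The test function is
  \<open>f(x) = \<Sum> e(n \<bullet> x)\<close> over the frequencies \<open>n = a + p m\<close> with \<open>m \<in> {0..<L}\<^sup>d\<close>, where \<open>e(y)\<close> is
  \<open>exp(2 \<pi> i y)\<close>. As \<open>P(a + p m) \<equiv> P(a) + p (v \<bullet> m)\<close> modulo \<open>p\<^sup>2\<close>, at time \<open>t = j / p\<^sup>2\<close> the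
  propagator only translates \<open>f\<close>, up to a factor of modulus \<open>1\<close>: all summands are in phase at \<open>x = W / p\<^sup>2\<close> whenever
  \<open>W \<equiv> - j v\<close> modulo \<open>p\<close>, and \<open>|e\<^sup>i\<^sup>t\<^sup>P\<^sup>(\<^sup>D\<^sup>) f| \<ge> L\<^sup>d / 2\<close> within distance of order \<open>1 / (p L)\<close>
  of that point (\<open>propagator_refocuses\<close>). A single \<open>j\<close> gives \<open>p\<^sup>d\<close> points on the torus; as \<open>j\<close>
  varies there are \<open>p\<^bsup>d + 1\<^esup>\<close> of them.

  Place on the cubes of side \<open>\<eta> \<approx> 1 / (p L)\<close> at these points the density \<open>\<eta>\<^bsup>\<alpha> - d\<^esup>\<close>. With
  \<open>p L = p\<^bsup>(d + 1) / \<alpha>\<^esup>\<close> the total mass is of order \<open>1\<close>, so the maximal estimate would give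
  \<open>L\<^bsup>2 d\<^esup> \<lesssim> (p L)\<^bsup>2 s\<^esup> L\<^sup>d\<close>, that is \<open>p\<^bsup>d (d + 1 - \<alpha>) / \<alpha>\<^esup> \<lesssim> p\<^bsup>2 s (d + 1) / \<alpha>\<^esup>\<close>; letting
  \<open>p \<rightarrow> \<infinity>\<close> gives the claim.

  The Frostman condition holds, with a constant independent of \<open>p\<close>, if the \<open>p\<^bsup>d + 1\<^esup>\<close> points are
  as far apart as their number permits, namely \<open>p\<^bsup>- (d + 1) / d\<^esup>\<close> up to a constant
  (\<open>frostman_cubes_measure\<close>). They form a lattice, and by the pigeonhole principle it has no
  shorter vector if \<open>v\<close> satisfies no linear relation \<open>k \<bullet> v \<equiv> 0\<close> modulo \<open>p\<close> with
  \<open>0 < |k| \<lesssim> p\<^bsup>1 / d\<^esup>\<close> (\<open>lattice_vector_large\<close>).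

  This is where non-singularity enters. It makes the partial derivatives of \<open>P\<close> linearly
  independent, so each relation \<open>k\<close> excludes few \<open>a\<close> on a suitable curve, and there are
  fewer than \<open>p\<close> excluded points in total (\<open>gradient_avoids_short_relations\<close>).
\<close>

section \<open>Integer polynomials\<close>

definition monomial_eval :: "('n::finite \<Rightarrow>\<^sub>0 nat) \<Rightarrow> 'a::comm_ring_1 ^ 'n \<Rightarrow> 'a" where
  "monomial_eval m x = (\<Prod>i\<in>UNIV. (x $ i) ^ Poly_Mapping.lookup m i)"

lemma mpoly_eval_superset:
  assumes "finite M" and "Poly_Mapping.keys P \<subseteq> M"
  shows "mpoly_eval P x = (\<Sum>m\<in>M. of_int (Poly_Mapping.lookup P m) * monomial_eval m x)"
  unfolding mpoly_eval_def monomial_eval_def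
  by (rule sum.mono_neutral_left) (use assms in \<open>auto simp: in_keys_iff\<close>)

lemma mpoly_eval_zero: "mpoly_eval 0 x = 0"
  by (simp add: mpoly_eval_def)

lemma mpoly_eval_add: "mpoly_eval (P + Q) x = mpoly_eval P x + mpoly_eval Q x"
proof -
  let ?M = "Poly_Mapping.keys P \<union> Poly_Mapping.keys Q"
  have "Poly_Mapping.keys (P + Q) \<subseteq> ?M"
    by (rule Poly_Mapping.keys_add)
  then show ?thesis
    by (simp add: mpoly_eval_superset[of ?M] lookup_add distrib_right sum.distrib)
qed

lemma mpoly_eval_sum: "mpoly_eval (sum F A) x = (\<Sum>a\<in>A. mpoly_eval (F a) x)"
  by (induction A rule: infinite_finite_induct) (simp_all add: mpoly_eval_zero mpoly_eval_add)

lemma mpoly_eval_single: "mpoly_eval (Poly_Mapping.single m c) x = of_int c * monomial_eval m x"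
  by (simp add: mpoly_eval_superset[of "{m}"])

lemma mpoly_eval_pderiv:
  "mpoly_eval (mpoly_pderiv i P) x =
     (\<Sum>m\<in>Poly_Mapping.keys P. of_int (int (Poly_Mapping.lookup m i) * Poly_Mapping.lookup P m)
        * monomial_eval (m - Poly_Mapping.single i 1) x)"
  by (simp add: mpoly_pderiv_def mpoly_eval_sum mpoly_eval_single)

lemma lookup_mpoly_pderiv:
  "Poly_Mapping.lookup (mpoly_pderiv i P) m =
     int (Poly_Mapping.lookup m i + 1) * Poly_Mapping.lookup P (m + Poly_Mapping.single i 1)"
proof -
  let ?e = "Poly_Mapping.single i (1::nat)"
  have eq: "Poly_Mapping.lookup (Poly_Mapping.single (m' - ?e)
          (int (Poly_Mapping.lookup m' i) * Poly_Mapping.lookup P m')) m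
      = (if m' = m + ?e then int (Poly_Mapping.lookup m i + 1) * Poly_Mapping.lookup P m' else 0)" for m'
  proof (cases "Poly_Mapping.lookup m' i = 0")
    case True
    then have "m' \<noteq> m + ?e"
      by (auto simp: lookup_add lookup_single)
    then show ?thesis using True by simp
  next
    case False
    have "m' - ?e = m \<longleftrightarrow> m' = m + ?e"
    proof
      assume "m' - ?e = m"
      then show "m' = m + ?e"
        using False by (intro poly_mapping_eqI) (auto simp: lookup_add lookup_minus lookup_single when_def)
    qed simp
    then show ?thesis
      by (auto simp: lookup_single when_def lookup_add)
  qed
  show ?thesis
    unfolding mpoly_pderiv_def lookup_sum eq
    by (auto simp: sum.delta in_keys_iff)
qed

lemma lookup_homogeneous_part:
  "Poly_Mapping.lookup (homogeneous_part k P) m = (if monom_degree m = k then Poly_Mapping.lookup P m else 0)"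
proof -
  have "Poly_Mapping.lookup (homogeneous_part k P) m
      = (\<Sum>m'\<in>{m \<in> Poly_Mapping.keys P. monom_degree m = k}. if m' = m then Poly_Mapping.lookup P m else 0)"
    unfolding homogeneous_part_def lookup_sum
    by (rule sum.cong) (auto simp: lookup_single when_def)
  also have "\<dots> = (if monom_degree m = k then Poly_Mapping.lookup P m else 0)"
    by (subst sum.delta) (auto simp: in_keys_iff)
  finally show ?thesis .
qed

lemma poly_mpoly_eval:
  fixes c :: "'a::comm_ring_1 poly ^ 'n::finite"
  shows "poly (mpoly_eval P c) s = mpoly_eval P (\<chi> i. poly (c $ i) s)"
  by (simp add: mpoly_eval_def poly_sum poly_prod poly_mult poly_power of_int_poly)

lemma pderiv_sum: "pderiv (sum F A) = (\<Sum>a\<in>A. pderiv (F a))"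
  by (induction A rule: infinite_finite_induct) (simp_all add: pderiv_add)

text \<open>
  The chain rule. Evaluating a multivariate polynomial at a vector of one-variable polynomials
  restricts it to a curve; affine curves give directional derivatives and Taylor expansions, and
  the curve \<open>x\<^sub>i = X\<^bsup>B^i\<^esup>\<close> separates monomials.
\<close>

lemma pderiv_mpoly_eval:
  fixes c :: "'a::{comm_ring_1,semiring_no_zero_divisors} poly ^ 'n::finite"
  shows "pderiv (mpoly_eval P c) = (\<Sum>i\<in>UNIV. mpoly_eval (mpoly_pderiv i P) c * pderiv (c $ i))"
proof -
  have mono: "pderiv (monomial_eval m c) =
     (\<Sum>i\<in>UNIV. of_nat (Poly_Mapping.lookup m i) * monomial_eval (m - Poly_Mapping.single i 1) c * pderiv (c $ i))"
    for m
  proof -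
    have *: "monomial_eval (m - Poly_Mapping.single i 1) c
        = (\<Prod>j\<in>UNIV - {i}. (c $ j) ^ Poly_Mapping.lookup m j) * (c $ i) ^ (Poly_Mapping.lookup m i - 1)" for i
      unfolding monomial_eval_def
      by (subst prod.remove[of UNIV i]) (auto simp: lookup_minus lookup_single mult.commute intro!: prod.cong)
    have "pderiv ((c $ i) ^ n) = of_nat n * (c $ i) ^ (n - 1) * pderiv (c $ i)" for i n
      by (simp add: pderiv_power of_nat_poly)
    then show ?thesis
      unfolding * by (simp add: monomial_eval_def pderiv_prod mult_ac)
  qed
  have "pderiv (mpoly_eval P c)
      = (\<Sum>m\<in>Poly_Mapping.keys P. of_int (Poly_Mapping.lookup P m) * pderiv (monomial_eval m c))"
    by (simp add: mpoly_eval_superset[OF finite_keys order_refl] pderiv_sum of_int_poly pderiv_smult)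
  also have "\<dots> = (\<Sum>i\<in>UNIV. mpoly_eval (mpoly_pderiv i P) c * pderiv (c $ i))"
    unfolding mono mpoly_eval_pderiv sum_distrib_left sum_distrib_right
    by (subst sum.swap) (simp add: mult_ac)
  finally show ?thesis .
qed


section \<open>Linear independence of the gradient\<close>

text \<open>
  The \<open>e i\<close> are digits in base \<open>B\<close>, at the positions \<open>w i\<close>.
\<close>

lemma kronecker_exponents_inj:
  fixes w e e' :: "'n::finite \<Rightarrow> nat"
  assumes "inj w" and e: "\<And>i. e i < B" and e': "\<And>i. e' i < B"
    and eq: "(\<Sum>i\<in>UNIV. B ^ w i * e i) = (\<Sum>i\<in>UNIV. B ^ w i * e' i)"
  shows "e = e'"
proof (rule ccontr)
  assume "e \<noteq> e'"
  define \<delta> where "\<delta> i = int (e i) - int (e' i)" for i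
  from \<open>e \<noteq> e'\<close> have ne: "{i. \<delta> i \<noteq> 0} \<noteq> {}"
    by (auto simp: \<delta>_def fun_eq_iff)
  \<comment> \<open>The lowest differing digit: modulo \<open>B ^ Suc (w j)\<close> only this digit contributes.\<close>
  then obtain j where j: "\<delta> j \<noteq> 0" and min: "\<And>i. \<delta> i \<noteq> 0 \<Longrightarrow> w j \<le> w i"
    using ex_has_least_nat[of "\<lambda>i. \<delta> i \<noteq> 0" _ w] by (metis (mono_tags, lifting) Collect_empty_eq)
  have "int (\<Sum>i\<in>UNIV. B ^ w i * e i) = int (\<Sum>i\<in>UNIV. B ^ w i * e' i)"
    by (simp only: eq)
  then have "(\<Sum>i\<in>UNIV. int B ^ w i * \<delta> i) = 0"
    by (simp add: \<delta>_def right_diff_distrib sum_subtractf)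
  then have "int B ^ w j * \<delta> j = - (\<Sum>i\<in>UNIV - {j}. int B ^ w i * \<delta> i)"
    by (subst (asm) sum.remove[of UNIV j]) auto
  moreover have "int B ^ Suc (w j) dvd (\<Sum>i\<in>UNIV - {j}. int B ^ w i * \<delta> i)"
  proof (rule dvd_sum)
    fix i assume i: "i \<in> UNIV - {j}"
    show "int B ^ Suc (w j) dvd int B ^ w i * \<delta> i"
    proof (cases "\<delta> i = 0")
      case False
      then have "w j \<le> w i" by (rule min)
      moreover have "w j \<noteq> w i" using i \<open>inj w\<close> by (auto dest: injD)
      ultimately have "Suc (w j) \<le> w i" by simp
      then show ?thesis by (intro dvd_mult2 le_imp_power_dvd)
    qed simp
  qed
  ultimately have "int B ^ w j * int B dvd int B ^ w j * \<delta> j"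
    by (simp add: mult.commute)
  moreover have "B > 0" using e[of j] by simp
  ultimately have "int B dvd \<delta> j" by simp
  moreover have "\<bar>\<delta> j\<bar> < int B" using e[of j] e'[of j] by (auto simp: \<delta>_def)
  ultimately show False using j by (meson dvd_imp_le_int not_less abs_ge_self order.trans abs_of_nat)
qed

text \<open>
  If all coefficients of the derivative of \<open>P\<close> in the direction \<open>k\<close> vanished, so would those
  of the derivative of its leading form \<open>Q\<close>. Then \<open>Q\<close> is invariant under translation by \<open>k\<close>,
  and so is its gradient; in particular the gradient of \<open>Q\<close> has the same value at \<open>k\<close> and
  at \<open>0\<close>. The value at \<open>0\<close> is \<open>0\<close> since \<open>Q\<close> is homogeneous of degree at least \<open>2\<close>, so
  \<open>k\<close> is a nonzero singular point of \<open>Q\<close>.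
\<close>

lemma directional_derivative_nonzero:
  fixes P :: "'n::finite int_mpoly" and k :: "int ^ 'n"
  assumes deg: "mpoly_degree P \<ge> 2" and ns: "nonsingular P" and "k \<noteq> 0"
  shows "\<exists>m. (\<Sum>i\<in>UNIV. k $ i * Poly_Mapping.lookup (mpoly_pderiv i P) m) \<noteq> 0"
proof (rule ccontr)
  assume "\<not> ?thesis"
  then have zero: "(\<Sum>i\<in>UNIV. k $ i * Poly_Mapping.lookup (mpoly_pderiv i P) m) = 0" for m
    by blast
  define Q where "Q = homogeneous_part (mpoly_degree P) P"
  define z :: "complex ^ 'n" where "z = of_int_vec k"
  have z: "z \<noteq> 0"
    using \<open>k \<noteq> 0\<close> by (auto simp: z_def of_int_vec_def vec_eq_iff)
  have deg_shift: "monom_degree (m + Poly_Mapping.single i 1) = Suc (monom_degree m)" for m and i :: 'n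
    by (simp add: monom_degree_def lookup_add sum.distrib lookup_single when_def)
  have lookup_Q: "Poly_Mapping.lookup (mpoly_pderiv i Q) m =
      (if Suc (monom_degree m) = mpoly_degree P then Poly_Mapping.lookup (mpoly_pderiv i P) m else 0)" for i m
    by (simp add: Q_def lookup_mpoly_pderiv lookup_homogeneous_part deg_shift del: One_nat_def)
  have zero_Q: "(\<Sum>i\<in>UNIV. k $ i * Poly_Mapping.lookup (mpoly_pderiv i Q) m) = 0" for m
    by (cases "Suc (monom_degree m) = mpoly_degree P") (simp_all add: lookup_Q zero)
  define M where "M = (\<Union>i. Poly_Mapping.keys (mpoly_pderiv i Q))"
  have M: "finite M" "Poly_Mapping.keys (mpoly_pderiv i Q) \<subseteq> M" for i
    by (auto simp: M_def)
  have dir: "(\<Sum>i\<in>UNIV. mpoly_eval (mpoly_pderiv i Q) x * z $ i) = 0" for x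
  proof -
    have "(\<Sum>i\<in>UNIV. mpoly_eval (mpoly_pderiv i Q) x * z $ i)
        = (\<Sum>m\<in>M. of_int (\<Sum>i\<in>UNIV. k $ i * Poly_Mapping.lookup (mpoly_pderiv i Q) m) * monomial_eval m x)"
      unfolding mpoly_eval_superset[OF M] z_def of_int_vec_def of_int_sum sum_distrib_right
      by (subst sum.swap) (simp add: mult_ac)
    also have "\<dots> = 0"
      by (simp only: zero_Q) simp
    finally show ?thesis .
  qed
  have shift: "mpoly_eval Q (y + z) = mpoly_eval Q y" for y
  proof -
    define q where "q = mpoly_eval Q (\<chi> i. [:y $ i, z $ i:])"
    have "poly (pderiv q) s = 0" for s
      unfolding q_def pderiv_mpoly_eval
      using dir[of "\<chi> i. y $ i + s * z $ i"]
      by (simp add: poly_sum poly_mpoly_eval pderiv_pCons mult.commute)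
    then have "pderiv q = 0"
      using poly_all_0_iff_0 by blast
    then have "degree q = 0"
      by (simp add: pderiv_eq_0_iff)
    then obtain c where "q = [:c:]" by (rule degree_eq_zeroE)
    then have "poly q 1 = poly q 0" by simp
    then show ?thesis
      by (simp add: q_def poly_mpoly_eval plus_vec_def)
  qed
  have "mpoly_gradient Q z $ j = 0" for j
  proof -
    define q where "q y = mpoly_eval Q (\<chi> i. [:y $ i, axis j 1 $ i:])" for y :: "complex ^ 'n"
    have poly_q: "poly (pderiv (q y)) 0 = mpoly_eval (mpoly_pderiv j Q) y" for y
    proof -
      have pd: "pderiv [:y $ i, axis j 1 $ i:] = (if i = j then 1 else 0)" for i
        by (simp add: pderiv_pCons axis_def)
      then have "pderiv (q y) = mpoly_eval (mpoly_pderiv j Q) (\<chi> i. [:y $ i, axis j 1 $ i:])"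
        unfolding q_def pderiv_mpoly_eval vec_lambda_beta pd by (simp add: if_distrib cong: if_cong)
      then show ?thesis
        by (simp add: poly_mpoly_eval)
    qed
    have "poly (q z) s = poly (q 0) s" for s
      using shift[of "\<chi> i. s * axis j 1 $ i"]
      by (simp add: q_def poly_mpoly_eval plus_vec_def mult.commute add.commute)
    then have "q z = q 0" by (simp add: poly_eq_poly_eq_iff[symmetric] fun_eq_iff)
    then have "mpoly_eval (mpoly_pderiv j Q) z = mpoly_eval (mpoly_pderiv j Q) 0"
      by (metis poly_q)
    also have "\<dots> = 0"
      unfolding mpoly_eval_superset[OF finite_keys order_refl]
    proof (rule sum.neutral, rule ballI)
      fix m assume "m \<in> Poly_Mapping.keys (mpoly_pderiv j Q)"
      then have "monom_degree m \<noteq> 0"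
        using deg by (auto simp: in_keys_iff lookup_Q split: if_splits)
      then obtain i where "Poly_Mapping.lookup m i \<noteq> 0"
        by (auto simp: monom_degree_def)
      then have "monomial_eval m (0 :: complex ^ 'n) = 0"
        unfolding monomial_eval_def by (intro prod_zero) auto
      then show "of_int (Poly_Mapping.lookup (mpoly_pderiv j Q) m) * monomial_eval m (0 :: complex ^ 'n) = 0"
        by simp
    qed
    finally show ?thesis by (simp add: mpoly_gradient_def)
  qed
  then have "mpoly_gradient Q z = 0" by (simp add: vec_eq_iff)
  with ns z show False by (simp add: nonsingular_def Q_def)
qed

text \<open>
  On the curve \<open>x\<^sub>i = X\<^bsup>B^i\<^esup>\<close> with \<open>B\<close> above all exponents, distinct monomials restrict to
  distinct powers of \<open>X\<close>, so a nonzero combination of the partial derivatives remains nonzero.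
  One curve serves all \<open>k\<close>; this reduces the counting of zeros to one variable.
\<close>

lemma independent_gradient_on_curve:
  fixes P :: "'n::finite int_mpoly"
  assumes "mpoly_degree P \<ge> 2" and "nonsingular P"
  shows "\<exists>c :: int poly ^ 'n. \<forall>k :: int ^ 'n. k \<noteq> 0 \<longrightarrow>
    (\<Sum>i\<in>UNIV. of_int (k $ i) * mpoly_eval (mpoly_pderiv i P) c) \<noteq> 0"
proof -
  define M where "M = (\<Union>i. Poly_Mapping.keys (mpoly_pderiv i P))"
  have M: "finite M" "Poly_Mapping.keys (mpoly_pderiv i P) \<subseteq> M" for i
    by (auto simp: M_def)
  have "finite ((\<lambda>(m, i). Poly_Mapping.lookup m i) ` (M \<times> UNIV))"
    using M(1) by simp
  then have "\<exists>B. \<forall>e\<in>(\<lambda>(m, i). Poly_Mapping.lookup m i) ` (M \<times> UNIV). e < B"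
    by (simp only: finite_nat_set_iff_bounded)
  then obtain B where "\<forall>e\<in>(\<lambda>(m, i). Poly_Mapping.lookup m i) ` (M \<times> UNIV). e < B" ..
  then have B: "Poly_Mapping.lookup m i < B" if "m \<in> M" for m i
    using that by auto
  define c :: "int poly ^ 'n" where "c = (\<chi> i. [:0, 1:] ^ (B ^ to_nat i))"
  define wt where "wt m = (\<Sum>i\<in>UNIV. B ^ to_nat i * Poly_Mapping.lookup m i)" for m :: "'n \<Rightarrow>\<^sub>0 nat"
  have wt_inj: "m = m'" if "m \<in> M" "m' \<in> M" "wt m = wt m'" for m m'
  proof -
    have "Poly_Mapping.lookup m = Poly_Mapping.lookup m'"
      by (rule kronecker_exponents_inj[of to_nat _ B]) (use that B in \<open>simp_all add: wt_def\<close>)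
    then show ?thesis by simp
  qed
  have mono: "monomial_eval m c = monom 1 (wt m)" for m
    unfolding monomial_eval_def c_def wt_def monom_altdef power_sum by (simp only: vec_lambda_beta power_mult smult_1_left)
  show ?thesis
  proof (intro exI allI impI notI)
    fix k :: "int ^ 'n"
    assume "k \<noteq> 0" and zero: "(\<Sum>i\<in>UNIV. of_int (k $ i) * mpoly_eval (mpoly_pderiv i P) c) = 0"
    define a where "a m = (\<Sum>i\<in>UNIV. k $ i * Poly_Mapping.lookup (mpoly_pderiv i P) m)" for m
    obtain m where m: "a m \<noteq> 0"
      using directional_derivative_nonzero[OF assms \<open>k \<noteq> 0\<close>] by (auto simp: a_def)
    have "m \<in> M"
    proof (rule ccontr)
      assume "m \<notin> M"
      then have "a m = 0" unfolding a_def M_def by (intro sum.neutral) (auto simp: in_keys_iff)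
      with m show False by simp
    qed
    have expand: "(\<Sum>i\<in>UNIV. of_int (k $ i) * mpoly_eval (mpoly_pderiv i P) c)
        = (\<Sum>m'\<in>M. of_int (a m') * monom 1 (wt m'))"
      unfolding mpoly_eval_superset[OF M] a_def of_int_sum sum_distrib_right sum_distrib_left mono
      by (subst sum.swap) (simp add: mult_ac)
    have "(0::int) = coeff (\<Sum>m'\<in>M. of_int (a m') * monom 1 (wt m')) (wt m)"
      unfolding expand[symmetric] zero by simp
    also have "\<dots> = (\<Sum>m'\<in>M. if m' = m then a m else 0)"
      unfolding coeff_sum
    proof (rule sum.cong)
      fix m' assume "m' \<in> M"
      then have "wt m' = wt m \<longleftrightarrow> m' = m"
        using wt_inj \<open>m \<in> M\<close> by blast
      then show "coeff (of_int (a m') * monom 1 (wt m')) (wt m) = (if m' = m then a m else 0)"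
        by (simp add: of_int_poly smult_monom)
    qed simp
    also have "\<dots> = a m" using M \<open>m \<in> M\<close> by simp
    finally show False using m by simp
  qed
qed

lemma card_roots_mod_prime:
  fixes q :: "int poly" and p :: int
  assumes "prime p" and "\<exists>i. \<not> p dvd coeff q i"
  shows "card {x \<in> {0..<p}. p dvd poly q x} \<le> degree q"
  using assms(2)
proof (induction "degree q" arbitrary: q rule: less_induct)
  case less
  show ?case
  proof (cases "\<exists>a\<in>{0..<p}. p dvd poly q a")
    case False
    then have "{x \<in> {0..<p}. p dvd poly q x} = {}" by auto
    then show ?thesis by (metis card.empty le0)
  next
    case True
    then obtain a where a: "a \<in> {0..<p}" "p dvd poly q a" by blast
    define r where "r = synthetic_div q a"
    have q: "q + smult a r = pCons (poly q a) r"
      unfolding r_def by (rule synthetic_div_correct)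
    have coeff_q: "coeff q i = coeff (pCons (poly q a) r) i - a * coeff r i" for i
      using arg_cong[OF q, of "\<lambda>s. coeff s i"] by simp
    have r: "\<exists>i. \<not> p dvd coeff r i"
    proof (rule ccontr)
      assume "\<not> ?thesis"
      then have "p dvd coeff q i" for i
        unfolding coeff_q by (cases i) (use a in auto)
      with less.prems show False by blast
    qed
    then have "r \<noteq> 0" by auto
    then have deg: "degree q = Suc (degree r)"
      by (simp add: r_def degree_synthetic_div synthetic_div_eq_0_iff)
    have poly_q: "poly q x = (x - a) * poly r x + poly q a" for x
      using arg_cong[OF q, of "\<lambda>s. poly s x"] by (simp add: algebra_simps)
    have fin: "finite {x \<in> {0..<p}. p dvd poly r x}"
      by (rule finite_subset[of _ "{0..<p}"]) auto
    have "{x \<in> {0..<p}. p dvd poly q x} \<subseteq> insert a {x \<in> {0..<p}. p dvd poly r x}"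
    proof
      fix x assume x: "x \<in> {x \<in> {0..<p}. p dvd poly q x}"
      then have "p dvd (x - a) * poly r x + poly q a" using poly_q[of x] by simp
      then have "p dvd (x - a) * poly r x" using a dvd_add_left_iff by blast
      then have "p dvd x - a \<or> p dvd poly r x"
        using \<open>prime p\<close> by (simp add: prime_dvd_mult_iff)
      moreover have "x = a" if "p dvd x - a"
        
      proof -
        have "x mod p = a mod p" using that by (simp add: mod_eq_dvd_iff)
        then show ?thesis using x a by simp
      qed
      ultimately show "x \<in> insert a {x \<in> {0..<p}. p dvd poly r x}" using x by auto
    qed
    then have "card {x \<in> {0..<p}. p dvd poly q x} \<le> card (insert a {x \<in> {0..<p}. p dvd poly r x})"
      using fin by (intro card_mono) simp_all
    also have "\<dots> \<le> Suc (card {x \<in> {0..<p}. p dvd poly r x})"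
      using fin by (simp add: card_insert_if)
    also have "\<dots> \<le> Suc (degree r)" using less.hyps[of r] deg r by simp
    finally show ?thesis using deg by simp
  qed
qed


section \<open>A gradient vector with no short linear relation\<close>

lemma vec_box_card:
  fixes S :: "'a set"
  assumes "finite S"
  shows "finite {x :: 'a ^ 'n::finite. \<forall>i. x $ i \<in> S}"
    and "card {x :: 'a ^ 'n::finite. \<forall>i. x $ i \<in> S} = card S ^ CARD('n)"
proof -
  have bij: "bij_betw (\<lambda>f. vec_lambda f :: 'a ^ 'n) (PiE UNIV (\<lambda>_. S)) {x. \<forall>i. x $ i \<in> S}"
    by (rule bij_betwI[where g = vec_nth]) (auto simp: PiE_def)
  then show "finite {x :: 'a ^ 'n::finite. \<forall>i. x $ i \<in> S}"
    using bij_betw_finite finite_PiE[of UNIV "\<lambda>_. S"] assms by (metis finite)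
  show "card {x :: 'a ^ 'n::finite. \<forall>i. x $ i \<in> S} = card S ^ CARD('n)"
    using bij_betw_same_card[OF bij] by (simp add: card_PiE)
qed

text \<open>
  The expansion modulo \<open>r\<^sup>2\<close> is what makes the phase \<open>P(a + p m) j / p\<^sup>2\<close> linear in \<open>m\<close> modulo \<open>1\<close>.
\<close>

lemma poly_taylor_mod_square:
  fixes q :: "int poly"
  shows "r\<^sup>2 dvd poly q r - poly q 0 - r * poly (pderiv q) 0"
proof -
  have step: "r dvd poly q r - poly q 0" for q :: "int poly"
    by (cases q) simp
  show ?thesis
  proof (cases q)
    case (pCons a u)
    have "poly q r - poly q 0 - r * poly (pderiv q) 0 = r * (poly u r - poly u 0)"
      by (simp add: pCons pderiv_pCons algebra_simps)
    then show ?thesis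
      using step[of u] by (simp add: power2_eq_square mult_dvd_mono)
  qed
qed

lemma mpoly_eval_taylor_mod_square:
  fixes P :: "'n::finite int_mpoly" and x y :: "int ^ 'n"
  shows "r\<^sup>2 dvd mpoly_eval P (x + r *s y) - mpoly_eval P x
    - r * (\<Sum>i\<in>UNIV. mpoly_eval (mpoly_pderiv i P) x * y $ i)"
proof -
  define q where "q = mpoly_eval P (\<chi> i. [:x $ i, y $ i:])"
  have "poly q s = mpoly_eval P (x + s *s y)" for s
    by (simp add: q_def poly_mpoly_eval plus_vec_def vector_scalar_mult_def)
  moreover have "poly (pderiv q) 0 = (\<Sum>i\<in>UNIV. mpoly_eval (mpoly_pderiv i P) x * y $ i)"
    by (simp add: q_def pderiv_mpoly_eval poly_sum poly_mpoly_eval pderiv_pCons mult.commute)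
  ultimately show ?thesis
    using poly_taylor_mod_square[of r q] by simp
qed

lemma mpoly_eval_cong_mod:
  fixes P :: "'n::finite int_mpoly" and x y :: "int ^ 'n"
  shows "r dvd mpoly_eval P (x + r *s y) - mpoly_eval P x"
proof -
  let ?S = "r * (\<Sum>i\<in>UNIV. mpoly_eval (mpoly_pderiv i P) x * y $ i)"
  have "r dvd r\<^sup>2" by simp
  then have "r dvd mpoly_eval P (x + r *s y) - mpoly_eval P x - ?S"
    using mpoly_eval_taylor_mod_square by (rule dvd_trans)
  moreover have "r dvd ?S" by simp
  ultimately have "r dvd (mpoly_eval P (x + r *s y) - mpoly_eval P x - ?S) + ?S"
    by (rule dvd_add)
  then show ?thesis by (simp only: diff_add_cancel)
qed

lemma integer_root_bracket:
  fixes d E p :: nat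
  assumes "d > 0" and "0 < E" and "E \<le> p"
  shows "\<exists>K\<ge>1. E * K ^ d \<le> p \<and> p < E * (2 * K) ^ d"
proof -
  have "p < E * Suc p ^ d"
  proof -
    have "p < Suc p ^ 1" by simp
    also have "\<dots> \<le> Suc p ^ d" using \<open>d > 0\<close> by (intro power_increasing) auto
    also have "\<dots> \<le> E * Suc p ^ d" using \<open>0 < E\<close> by simp
    finally show ?thesis .
  qed
  define n where "n = (LEAST n. p < E * n ^ d)"
  have n: "p < E * n ^ d"
    unfolding n_def by (rule LeastI) fact
  have less: "E * j ^ d \<le> p" if "j < n" for j
    using not_less_Least that unfolding n_def by (metis not_less)
  have "n \<noteq> 0"
  proof
    assume "n = 0"
    with n \<open>d > 0\<close> show False by (simp add: zero_power)
  qed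
  moreover have "n \<noteq> 1" using n \<open>E \<le> p\<close> by auto
  ultimately obtain K where K: "n = Suc K" "K \<ge> 1"
    by (metis One_nat_def Suc_leI neq0_conv not0_implies_Suc)
  have "p < E * Suc K ^ d" using n K by simp
  also have "\<dots> \<le> E * (2 * K) ^ d"
    using K by (intro mult_left_mono power_mono) auto
  finally show ?thesis using less[of K] K by auto
qed

text \<open>
  A linear relation \<open>k\<close> with entries at most \<open>K\<close> restricts the gradient to a one-variable
  polynomial \<open>V k\<close> along the curve. Its coefficients are bounded by a multiple of \<open>K\<close>, hence
  smaller than \<open>p\<close>, so \<open>V k\<close> stays nonzero modulo \<open>p\<close> and has boundedly many roots. As there
  are about \<open>(2 K)\<^sup>d\<close> relations, fewer than \<open>p\<close> points of the curve satisfy any of them once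
  \<open>K\<^sup>d\<close> is a small multiple of \<open>p\<close>. By the pigeonhole principle \<open>K \<approx> p\<^bsup>1/d\<^esup>\<close> is the largest
  possible order of magnitude, and exactly this order is needed below.
\<close>

lemma gradient_avoids_short_relations:
  fixes P :: "'n::finite int_mpoly"
  assumes "mpoly_degree P \<ge> 2" and "nonsingular P"
  shows "\<exists>E::nat. 0 < E \<and> (\<forall>p::nat. prime p \<longrightarrow> E < p \<longrightarrow>
    (\<exists>K\<ge>1. \<exists>x :: int ^ 'n. E * K ^ CARD('n) \<le> p \<and> p < E * (2 * K) ^ CARD('n) \<and>
      (\<forall>i. 0 \<le> x $ i \<and> x $ i < int p) \<and>
      (\<forall>k. k \<noteq> 0 \<longrightarrow> (\<forall>i. \<bar>k $ i\<bar> \<le> int K) \<longrightarrow>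
        \<not> int p dvd (\<Sum>i\<in>UNIV. k $ i * mpoly_eval (mpoly_pderiv i P) x))))"
proof -
  let ?d = "CARD('n)"
  obtain c :: "int poly ^ 'n" where c: "\<And>k :: int ^ 'n. k \<noteq> 0 \<Longrightarrow>
      (\<Sum>i\<in>UNIV. of_int (k $ i) * mpoly_eval (mpoly_pderiv i P) c) \<noteq> 0"
    using independent_gradient_on_curve[OF assms] by blast
  define U where "U i = mpoly_eval (mpoly_pderiv i P) c" for i
  define V where "V k = (\<Sum>i\<in>UNIV. of_int (k $ i) * U i)" for k :: "int ^ 'n"
  define D where "D = (\<Sum>i\<in>UNIV. degree (U i))"
  define A where "A = (\<Sum>i\<in>UNIV. \<Sum>l\<le>D. nat \<bar>coeff (U i) l\<bar>)"
  \<comment> \<open>The number \<open>E * K ^ d\<close>, which is at most \<open>p\<close>, has to dominate both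
    the number \<open>(3 * K) ^ d * D\<close> of excluded points and the bound \<open>K * A\<close> on the coefficients of \<open>V k\<close>.\<close>
  define E where "E = 3 ^ ?d * (D + 1) + A + 1"
  have deg_U: "degree (U i) \<le> D" for i
    unfolding D_def by (rule member_le_sum) auto
  have coeff_V: "coeff (V k) l = (\<Sum>i\<in>UNIV. k $ i * coeff (U i) l)" for k l
    by (simp add: V_def coeff_sum of_int_poly)
  have deg_V: "degree (V k) \<le> D" for k
    by (rule degree_le) (auto simp: coeff_V intro!: sum.neutral coeff_eq_0 le_less_trans[OF deg_U])
  have coeff_bound: "\<bar>coeff (V k) l\<bar> \<le> int K * int A" if k: "\<And>i. \<bar>k $ i\<bar> \<le> int K" for k l K
  proof (cases "l \<le> D")
    case True
    have "\<bar>coeff (V k) l\<bar> \<le> (\<Sum>i\<in>UNIV. int K * \<bar>coeff (U i) l\<bar>)"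
      unfolding coeff_V by (rule order_trans[OF sum_abs sum_mono]) (auto simp: abs_mult k intro!: mult_right_mono)
    also have "\<dots> \<le> (\<Sum>i\<in>UNIV. int K * (\<Sum>l\<le>D. \<bar>coeff (U i) l\<bar>))"
      by (intro sum_mono mult_left_mono member_le_sum) (use True in auto)
    also have "\<dots> = int K * int A"
      by (simp add: A_def sum_distrib_left)
    finally show ?thesis .
  next
    case False
    then show ?thesis using deg_V[of k] by (simp add: coeff_eq_0)
  qed
  show ?thesis
  proof (rule exI[of _ E], intro conjI allI impI)
    show "0 < E" by (simp add: E_def)
    fix p :: nat assume p: "prime p" "E < p"
    obtain K where K: "K \<ge> 1" "E * K ^ ?d \<le> p" "p < E * (2 * K) ^ ?d"
      using integer_root_bracket[of ?d E p] p \<open>0 < E\<close> by auto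
    define S where "S = {k :: int ^ 'n. \<forall>i. k $ i \<in> {- int K..int K}}"
    have fin_S: "finite S" and card_S: "card S = (2 * K + 1) ^ ?d"
      using vec_box_card[of "{- int K..int K}", where 'n = 'n] by (simp_all add: S_def nat_add_distrib nat_mult_distrib)
    define Z where "Z k = {t \<in> {0..<int p}. int p dvd poly (V k) t}" for k
    have card_Z: "card (Z k) \<le> D" if "k \<in> S" "k \<noteq> 0" for k
    proof -
      have "V k \<noteq> 0" unfolding V_def U_def by (rule c) fact
      then obtain l where l: "coeff (V k) l \<noteq> 0" by (metis leading_coeff_0_iff)
      have "\<bar>coeff (V k) l\<bar> \<le> int K * int A"
        using that by (intro coeff_bound) (auto simp: S_def abs_le_iff minus_le_iff)
      also have "\<dots> < int p"
      proof -
        have "A < E" by (simp add: E_def)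
        then have "K * A < K * E" using K(1) by simp
        also have "\<dots> \<le> K ^ ?d * E" using K self_le_power[of K ?d] by simp
        finally have "K * A < p" using K by (simp add: mult.commute)
        then show ?thesis by (simp flip: of_nat_mult)
      qed
      finally have "\<not> int p dvd coeff (V k) l"
        using l zdvd_imp_le[of "int p" "\<bar>coeff (V k) l\<bar>"] by auto
      then have "card (Z k) \<le> degree (V k)"
        unfolding Z_def using p by (intro card_roots_mod_prime) auto
      with deg_V[of k] show ?thesis by simp
    qed
    have "card (\<Union>k\<in>S - {0}. Z k) \<le> (\<Sum>k\<in>S - {0}. card (Z k))"
      by (rule card_UN_le) (use fin_S in simp)
    also have "\<dots> \<le> (\<Sum>k\<in>S - {0}. D)"
      by (rule sum_mono) (use card_Z in auto)
    also have "\<dots> \<le> card S * D"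
      by (simp add: card_Diff1_le)
    also have "\<dots> \<le> (3 * K) ^ ?d * D"
      unfolding card_S using K by (intro mult_right_mono power_mono) auto
    also have "\<dots> = (3 ^ ?d * D) * K ^ ?d"
      by (simp add: power_mult_distrib mult_ac)
    also have "\<dots> < E * K ^ ?d"
      using K by (intro mult_strict_right_mono) (auto simp: E_def)
    also have "\<dots> \<le> p" by (rule K)
    finally have "card (\<Union>k\<in>S - {0}. Z k) < card {0..<int p}" by simp
    moreover have "(\<Union>k\<in>S - {0}. Z k) \<subseteq> {0..<int p}" by (auto simp: Z_def)
    ultimately obtain t where t: "t \<in> {0..<int p}" "t \<notin> (\<Union>k\<in>S - {0}. Z k)"
      by (metis less_irrefl subsetI subset_antisym)
    define x :: "int ^ 'n" where "x = (\<chi> i. poly (c $ i) t mod int p)"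
    have x_cong: "int p dvd poly (U i) t - mpoly_eval (mpoly_pderiv i P) x" for i
    proof -
      have "(\<chi> i. poly (c $ i) t) = x + int p *s (\<chi> i. poly (c $ i) t div int p)"
        by (simp add: x_def vec_eq_iff)
      then show ?thesis
        unfolding U_def poly_mpoly_eval using mpoly_eval_cong_mod[of "int p"] by metis
    qed
    have "\<not> int p dvd (\<Sum>i\<in>UNIV. k $ i * mpoly_eval (mpoly_pderiv i P) x)"
      if k: "k \<noteq> 0" "\<forall>i. \<bar>k $ i\<bar> \<le> int K" for k
    proof
      assume "int p dvd (\<Sum>i\<in>UNIV. k $ i * mpoly_eval (mpoly_pderiv i P) x)"
      moreover have "int p dvd (\<Sum>i\<in>UNIV. k $ i * (poly (U i) t - mpoly_eval (mpoly_pderiv i P) x))"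
        by (intro dvd_sum dvd_mult x_cong)
      ultimately have "int p dvd (\<Sum>i\<in>UNIV. k $ i * mpoly_eval (mpoly_pderiv i P) x)
          + (\<Sum>i\<in>UNIV. k $ i * (poly (U i) t - mpoly_eval (mpoly_pderiv i P) x))"
        by (rule dvd_add)
      also have "\<dots> = poly (V k) t"
        by (simp add: V_def poly_sum of_int_poly right_diff_distrib sum_subtractf)
      finally have "t \<in> Z k" using t by (simp add: Z_def)
      moreover have "k \<in> S" using k by (auto simp: S_def abs_le_iff minus_le_iff)
      ultimately show False using t k by auto
    qed
    moreover have "0 \<le> x $ i \<and> x $ i < int p" for i
      using p by (auto simp: x_def prime_gt_0_nat)
    ultimately show "\<exists>K\<ge>1. \<exists>x :: int ^ 'n. E * K ^ ?d \<le> p \<and> p < E * (2 * K) ^ ?d \<and>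
      (\<forall>i. 0 \<le> x $ i \<and> x $ i < int p) \<and>
      (\<forall>k. k \<noteq> 0 \<longrightarrow> (\<forall>i. \<bar>k $ i\<bar> \<le> int K) \<longrightarrow>
        \<not> int p dvd (\<Sum>i\<in>UNIV. k $ i * mpoly_eval (mpoly_pderiv i P) x))"
      using K by blast
  qed
qed


section \<open>The refocusing lattice\<close>

text \<open>
  Suppose that \<open>W \<equiv> j v\<close> modulo \<open>p\<close> is short. If \<open>p\<close> divides \<open>j\<close>, then \<open>W\<close> is a nonzero multiple
  of \<open>p\<close> and has an entry of size at least \<open>p\<close>. Otherwise the integers \<open>k \<bullet> W\<close> with
  \<open>k \<in> {0..K}\<^sup>d\<close> lie in too short an interval to be distinct, and a coincidence \<open>k \<bullet> W = k' \<bullet> W\<close> makes \<open>k - k'\<close> a short relation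
  for \<open>v\<close> modulo \<open>p\<close>.
\<close>

lemma lattice_vector_large:
  fixes v W :: "int ^ 'n::finite" and p K :: nat
  assumes p: "prime p" and K: "K \<ge> 1" "K ^ CARD('n) \<le> p"
    and short: "\<And>k :: int ^ 'n. k \<noteq> 0 \<Longrightarrow> (\<And>i. \<bar>k $ i\<bar> \<le> int K) \<Longrightarrow>
      \<not> int p dvd (\<Sum>i\<in>UNIV. k $ i * v $ i)"
    and W: "\<And>i. int p dvd W $ i - j * v $ i" and "W \<noteq> 0"
  shows "\<exists>i. real K ^ (CARD('n) - 1) / (4 * real CARD('n)) \<le> real_of_int \<bar>W $ i\<bar>"
proof (cases "int p dvd j")
  case True
  have dvd: "int p dvd W $ i" for i
    using dvd_add[OF W[of i] dvd_mult2[OF True, of "v $ i"]] by simp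
  obtain i where i: "W $ i \<noteq> 0" using \<open>W \<noteq> 0\<close> by (auto simp: vec_eq_iff)
  have "real K ^ (CARD('n) - 1) / (4 * real CARD('n)) \<le> real K ^ (CARD('n) - 1) / 1"
  proof (intro divide_left_mono)
    have "0 < CARD('n)" by simp
    then show "1 \<le> 4 * real CARD('n)" by linarith
  qed auto
  also have "\<dots> \<le> real K ^ CARD('n)"
    using K by (simp add: power_increasing)
  also have "\<dots> \<le> real p" using K by (simp flip: of_nat_power)
  also have "\<dots> \<le> real_of_int \<bar>W $ i\<bar>"
    using dvd[of i] i zdvd_imp_le[of "int p" "\<bar>W $ i\<bar>"] by simp
  finally show ?thesis by blast
next
  case False
  show ?thesis
  proof (rule ccontr)
    assume "\<not> ?thesis"
    then have small: "real_of_int \<bar>W $ i\<bar> \<le> real K ^ (CARD('n) - 1) / (4 * real CARD('n))" for i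
      by (meson not_le order.strict_implies_order)
    define \<phi> where "\<phi> k = (\<Sum>i\<in>UNIV. k $ i * W $ i)" for k
    define S where "S = {k :: int ^ 'n. \<forall>i. k $ i \<in> {0..int K}}"
    have card_S: "finite S" "card S = (K + 1) ^ CARD('n)"
      using vec_box_card[of "{0..int K}", where 'n = 'n] by (simp_all add: S_def nat_add_distrib)
    define T where "T = int (K ^ CARD('n) div 4)"
    have "\<phi> ` S \<subseteq> {- T..T}"
    proof (rule image_subsetI)
      fix k assume "k \<in> S"
      have "real_of_int \<bar>\<phi> k\<bar> \<le> (\<Sum>i\<in>UNIV. real_of_int \<bar>k $ i * W $ i\<bar>)"
        unfolding \<phi>_def of_int_sum[symmetric] by (intro of_int_le_iff[THEN iffD2] sum_abs)
      also have "\<dots> \<le> (\<Sum>i\<in>(UNIV::'n set). real K * (real K ^ (CARD('n) - 1) / (4 * real CARD('n))))"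
      proof (rule sum_mono)
        fix i
        have "\<bar>k $ i\<bar> \<le> int K" using \<open>k \<in> S\<close> by (auto simp: S_def)
        then have "real_of_int \<bar>k $ i\<bar> \<le> real_of_int (int K)" by (simp only: of_int_le_iff)
        then have "real_of_int \<bar>k $ i\<bar> \<le> real K" by simp
        then have "real_of_int \<bar>k $ i\<bar> * real_of_int \<bar>W $ i\<bar>
            \<le> real K * (real K ^ (CARD('n) - 1) / (4 * real CARD('n)))"
          by (intro mult_mono small) auto
        then show "real_of_int \<bar>k $ i * W $ i\<bar> \<le> real K * (real K ^ (CARD('n) - 1) / (4 * real CARD('n)))"
          by (simp add: abs_mult)
      qed
      also have "\<dots> = real (K ^ CARD('n)) / 4"
        using power_minus_mult[of "CARD('n)" "real K"] by (simp add: mult.commute)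
      finally have "4 * \<bar>\<phi> k\<bar> \<le> int (K ^ CARD('n))" by linarith
      then have "\<bar>\<phi> k\<bar> \<le> T" unfolding T_def by linarith
      then show "\<phi> k \<in> {- T..T}" by auto
    qed
    then have "card (\<phi> ` S) \<le> card {- T..T}" by (intro card_mono) auto
    also have "\<dots> = 2 * (K ^ CARD('n) div 4) + 1" by (simp add: T_def)
    also have "\<dots> < K ^ CARD('n) + 1"
    proof -
      have "2 * (a div 4) < a" if "0 < a" for a :: nat
        using that by linarith
      moreover have "0 < K ^ CARD('n)" using K by simp
      ultimately show ?thesis by simp
    qed
    also have "\<dots> \<le> (K + 1) ^ CARD('n)"
      using power_strict_mono[of K "K + 1" "CARD('n)"] by simp
    finally have "card (\<phi> ` S) < card S" using card_S by simp
    then have "\<not> inj_on \<phi> S" using card_image by force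
    then obtain k k' where k: "k \<in> S" "k' \<in> S" "\<phi> k = \<phi> k'" "k \<noteq> k'" by (auto simp: inj_on_def)
    have "int p dvd (\<Sum>i\<in>UNIV. (k - k') $ i * (W $ i - j * v $ i))"
      by (intro dvd_sum dvd_mult W)
    also have "\<dots> = (\<phi> k - \<phi> k') - j * (\<Sum>i\<in>UNIV. (k - k') $ i * v $ i)"
      by (simp add: \<phi>_def sum_subtractf sum_distrib_left algebra_simps sum.distrib)
    finally have "int p dvd j * (\<Sum>i\<in>UNIV. (k - k') $ i * v $ i)" using k by simp
    then have "int p dvd (\<Sum>i\<in>UNIV. (k - k') $ i * v $ i)"
      using False p by (simp add: prime_dvd_mult_iff)
    moreover have "k - k' \<noteq> 0" using k by simp
    moreover have "\<bar>(k - k') $ i\<bar> \<le> int K" for i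
    proof -
      have "k $ i \<in> {0..int K}" "k' $ i \<in> {0..int K}" using k by (auto simp: S_def)
      then show ?thesis by auto
    qed
    ultimately show False using short by blast
  qed
qed

text \<open>
  The solution refocuses at the points \<open>W / p\<^sup>2\<close> of the lattice \<open>{b / p + j v / p\<^sup>2}\<close>, which has
  covolume \<open>p\<^bsup>- (d + 1)\<^esup>\<close> if \<open>v\<close> is nonzero modulo \<open>p\<close>. One representative is taken from each
  class modulo \<open>\<int>\<^sup>d\<close>.
\<close>

definition refocusing_points :: "nat \<Rightarrow> int ^ 'n \<Rightarrow> (int ^ 'n) set" where
  "refocusing_points p v =
     {W. (\<forall>i. W $ i \<in> {0..<(int p)\<^sup>2}) \<and> (\<exists>j. \<forall>i. int p dvd W $ i - j * v $ i)}"

lemma finite_refocusing_points: "finite (refocusing_points p (v :: int ^ 'n::finite))"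
  by (rule finite_subset[OF _ vec_box_card(1)[of "{0..<(int p)\<^sup>2}"]]) (auto simp: refocusing_points_def)

lemma card_refocusing_points:
  fixes v :: "int ^ 'n::finite"
  assumes p: "prime p" and v: "\<not> int p dvd v $ i\<^sub>0"
  shows "p ^ (CARD('n) + 1) \<le> card (refocusing_points p v)"
proof -
  have "p > 0" using p by (simp add: prime_gt_0_nat)
  define S where "S = {c :: int ^ 'n. \<forall>i. c $ i \<in> {0..<int p}}"
  have card_S: "finite S" "card S = p ^ CARD('n)"
    using vec_box_card[of "{0..<int p}", where 'n = 'n] by (simp_all add: S_def)
  define \<phi> :: "int \<times> (int ^ 'n) \<Rightarrow> int ^ 'n"
    where "\<phi> = (\<lambda>(j, c). \<chi> i. (j * v $ i) mod int p + int p * c $ i)"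
  have inj: "inj_on \<phi> ({0..<int p} \<times> S)"
  proof (rule inj_onI, clarsimp)
    fix j j' c c' assume j: "0 \<le> j" "j < int p" "0 \<le> j'" "j' < int p" and c: "c \<in> S" "c' \<in> S"
      and eq: "\<phi> (j, c) = \<phi> (j', c')"
    have eq_i: "(j * v $ i) mod int p + int p * c $ i = (j' * v $ i) mod int p + int p * c' $ i" for i
      using arg_cong[OF eq, of "\<lambda>x. x $ i"] by (simp add: \<phi>_def)
    have "((j * v $ i\<^sub>0) mod int p + int p * c $ i\<^sub>0) mod int p = ((j' * v $ i\<^sub>0) mod int p + int p * c' $ i\<^sub>0) mod int p"
      by (simp only: eq_i)
    then have "(j * v $ i\<^sub>0) mod int p = (j' * v $ i\<^sub>0) mod int p" by simp
    then have "int p dvd (j - j') * v $ i\<^sub>0" by (simp add: mod_eq_dvd_iff left_diff_distrib)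
    then have "int p dvd j - j'" using p v by (simp add: prime_dvd_mult_iff)
    then have "j mod int p = j' mod int p" by (simp add: mod_eq_dvd_iff)
    then have "j = j'" using j by simp
    moreover from this have "c $ i = c' $ i" for i using eq_i[of i] \<open>p > 0\<close> by simp
    ultimately show "j = j' \<and> c = c'" by (simp add: vec_eq_iff)
  qed
  have "\<phi> ` ({0..<int p} \<times> S) \<subseteq> refocusing_points p v"
  proof (clarsimp simp: refocusing_points_def, intro conjI allI)
    fix j c assume "0 \<le> j" "j < int p" and c: "c \<in> S"
    fix i
    have ci: "0 \<le> c $ i" "c $ i \<le> int p - 1" using c by (auto simp: S_def)
    have m: "0 \<le> (j * v $ i) mod int p" "(j * v $ i) mod int p < int p" using \<open>p > 0\<close> by auto
    show "0 \<le> \<phi> (j, c) $ i" using ci m by (simp add: \<phi>_def)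
    have "int p * c $ i \<le> int p * (int p - 1)" using ci by (intro mult_left_mono) auto
    then show "\<phi> (j, c) $ i < (int p)\<^sup>2" using m by (simp add: \<phi>_def power2_eq_square right_diff_distrib)
  next
    fix j c
    show "\<exists>j'. \<forall>i. int p dvd \<phi> (j, c) $ i - j' * v $ i"
    proof (intro exI allI)
      fix i
      have "\<phi> (j, c) $ i - j * v $ i = int p * (c $ i - (j * v $ i) div int p)"
        using div_mult_mod_eq[of "j * v $ i" "int p"] by (simp add: \<phi>_def algebra_simps)
      then show "int p dvd \<phi> (j, c) $ i - j * v $ i" by simp
    qed
  qed
  then have "card (\<phi> ` ({0..<int p} \<times> S)) \<le> card (refocusing_points p v)"
    by (intro card_mono finite_refocusing_points)
  then show ?thesis
    by (simp add: card_image[OF inj] card_cartesian_product card_S)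
qed


section \<open>Frostman measures carried by small cubes\<close>

lemma dist_torus_proj_le: "dist (torus_proj x) (torus_proj y) \<le> dist x y"
proof transfer
  fix x y :: "real ^ 'n"
  show "infdist (x - y) int_lattice \<le> dist x y"
    using infdist_le[OF int_lattice_zero, of "x - y"] by (simp add: dist_norm)
qed

lemma continuous_on_torus_proj: "continuous_on A torus_proj"
  unfolding continuous_on_iff by (meson dist_torus_proj_le le_less_trans)

lemma measurable_torus_proj [measurable]: "torus_proj \<in> borel_measurable borel"
  by (intro borel_measurable_continuous_onI continuous_on_torus_proj)

lemma torus_proj_in_ball:
  assumes "torus_proj u \<in> ball x r"
  obtains m where "m \<in> int_lattice" and "norm (rep_torus x - (u + m)) < r"
proof -
  have "torus_proj (rep_torus x) = x"
    using Quotient3_torus Quotient3_abs_rep by fastforce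
  then have "infdist (rep_torus x - u) int_lattice < r"
    using assms by (metis dist_torus.abs_eq mem_ball)
  moreover have "int_lattice \<noteq> ({} :: (real ^ 'a) set)"
    using int_lattice_zero by blast
  ultimately obtain m where "m \<in> int_lattice" "dist (rep_torus x - u) m < r"
    by (auto simp: infdist_notempty cInf_less_iff)
  then show ?thesis
    using that by (simp add: dist_norm diff_diff_eq)
qed

text \<open>
  The cells of a grid of mesh \<open>\<rho>\<close> contain at most one of the points each.
\<close>

lemma card_separated_points:
  fixes F :: "(real ^ 'n::finite) set"
  assumes "0 < \<rho>" and "0 \<le> s"
    and sep: "\<And>w w'. w \<in> F \<Longrightarrow> w' \<in> F \<Longrightarrow> w \<noteq> w' \<Longrightarrow> \<exists>i. \<rho> \<le> \<bar>w $ i - w' $ i\<bar>"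
    and near: "\<And>w i. w \<in> F \<Longrightarrow> \<bar>w $ i - x $ i\<bar> \<le> s"
  shows "finite F" and "real (card F) \<le> (2 * s / \<rho> + 2) ^ CARD('n)"
proof -
  define S where "S = {\<lfloor>- s / \<rho>\<rfloor>..\<lfloor>s / \<rho>\<rfloor>}"
  define \<phi> :: "real ^ 'n \<Rightarrow> int ^ 'n" where "\<phi> w = (\<chi> i. \<lfloor>(w $ i - x $ i) / \<rho>\<rfloor>)" for w
  have inj: "inj_on \<phi> F"
  proof (rule inj_onI, rule ccontr)
    fix w w' assume w: "w \<in> F" "w' \<in> F" "\<phi> w = \<phi> w'" "w \<noteq> w'"
    then obtain i where i: "\<rho> \<le> \<bar>w $ i - w' $ i\<bar>" using sep by blast
    have "\<lfloor>(w $ i - x $ i) / \<rho>\<rfloor> = \<lfloor>(w' $ i - x $ i) / \<rho>\<rfloor>"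
      using arg_cong[OF w(3), of "\<lambda>v. v $ i"] by (simp add: \<phi>_def)
    then have "\<bar>(w $ i - x $ i) / \<rho> - (w' $ i - x $ i) / \<rho>\<bar> < 1" by linarith
    also have "(w $ i - x $ i) / \<rho> - (w' $ i - x $ i) / \<rho> = (w $ i - w' $ i) / \<rho>"
      by (simp flip: diff_divide_distrib)
    finally show False using i \<open>0 < \<rho>\<close> by simp
  qed
  have sub: "\<phi> ` F \<subseteq> {k. \<forall>i. k $ i \<in> S}"
  proof (clarsimp simp: \<phi>_def S_def)
    fix w i assume "w \<in> F"
    then have "\<bar>w $ i - x $ i\<bar> \<le> s" by (rule near)
    then have "- s / \<rho> \<le> (w $ i - x $ i) / \<rho>" "(w $ i - x $ i) / \<rho> \<le> s / \<rho>"
      using \<open>0 < \<rho>\<close> by (intro divide_right_mono; linarith)+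
    then show "\<lfloor>- (s / \<rho>)\<rfloor> \<le> \<lfloor>(w $ i - x $ i) / \<rho>\<rfloor> \<and> \<lfloor>(w $ i - x $ i) / \<rho>\<rfloor> \<le> \<lfloor>s / \<rho>\<rfloor>"
      by (simp add: floor_mono)
  qed
  have fin: "finite {k :: int ^ 'n. \<forall>i. k $ i \<in> S}" and card: "card {k :: int ^ 'n. \<forall>i. k $ i \<in> S} = card S ^ CARD('n)"
    using vec_box_card[of S, where 'n = 'n] by (simp_all add: S_def)
  show "finite F"
    using finite_imageD[OF finite_subset[OF sub fin] inj] .
  show "real (card F) \<le> (2 * s / \<rho> + 2) ^ CARD('n)"
  proof -
    have s: "0 \<le> s / \<rho>" using \<open>0 < \<rho>\<close> \<open>0 \<le> s\<close> by simp
    have "card F \<le> card S ^ CARD('n)"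
      using card_mono[OF fin sub] by (simp add: card_image[OF inj] card)
    then have "real (card F) \<le> real (card S) ^ CARD('n)"
      by (simp flip: of_nat_power)
    also have "real (card S) \<le> 2 * s / \<rho> + 2"
      using s by (simp add: S_def) linarith
    then have "real (card S) ^ CARD('n) \<le> (2 * s / \<rho> + 2) ^ CARD('n)"
      by (intro power_mono) auto
    finally show ?thesis .
  qed
qed

definition cubes_measure :: "real \<Rightarrow> real \<Rightarrow> (real ^ 'n::finite) set \<Rightarrow> 'n torus measure" where
  "cubes_measure c \<eta> Y =
     distr (density lborel (\<lambda>u. \<Sum>y\<in>Y. ennreal c * indicator (cbox y (y + vec \<eta>)) u)) borel torus_proj"

lemma emeasure_cubes_measure:
  assumes "A \<in> sets borel"
  shows "emeasure (cubes_measure c \<eta> Y) A =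
    (\<Sum>y\<in>Y. ennreal c * emeasure lborel (cbox y (y + vec \<eta>) \<inter> torus_proj -` A))"
proof -
  have [measurable]: "torus_proj -` A \<in> sets borel"
    using measurable_sets[OF measurable_torus_proj assms] by simp
  have "emeasure (cubes_measure c \<eta> Y) A =
      (\<integral>\<^sup>+u. (\<Sum>y\<in>Y. ennreal c * indicator (cbox y (y + vec \<eta>)) u) * indicator (torus_proj -` A) u \<partial>lborel)"
    unfolding cubes_measure_def using assms
    by (subst emeasure_distr) (simp_all add: emeasure_density)
  also have "\<dots> = (\<integral>\<^sup>+u. (\<Sum>y\<in>Y. ennreal c * indicator (cbox y (y + vec \<eta>) \<inter> torus_proj -` A) u) \<partial>lborel)"
    by (simp add: sum_distrib_right indicator_inter_arith mult.assoc)
  also have "\<dots> = (\<Sum>y\<in>Y. ennreal c * emeasure lborel (cbox y (y + vec \<eta>) \<inter> torus_proj -` A))"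
    by (subst nn_integral_sum) (simp_all add: nn_integral_cmult)
  finally show ?thesis .
qed

lemma emeasure_cube:
  fixes y :: "real ^ 'n::finite"
  assumes "0 \<le> \<eta>"
  shows "emeasure lborel (cbox y (y + vec \<eta>)) = ennreal (\<eta> ^ CARD('n))"
proof -
  have "\<forall>b\<in>Basis. y \<bullet> b \<le> (y + vec \<eta>) \<bullet> b"
    using assms by (auto simp: Basis_vec_def inner_axis)
  moreover have "(\<Prod>b\<in>Basis. (y + vec \<eta> - y) \<bullet> b) = (\<Prod>b\<in>(Basis :: (real ^ 'n) set). \<eta>)"
    by (rule prod.cong) (auto simp: Basis_vec_def inner_axis)
  ultimately show ?thesis
    by (simp add: emeasure_lborel_cbox_eq)
qed

text \<open>
  The hypothesis \<open>\<eta> powr \<alpha> \<le> A * \<rho> ^ d\<close> says that a cube of side \<open>\<eta>\<close>, of mass \<open>\<eta> powr \<alpha>\<close>, carries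
  no more than its share if there is one such cube per volume \<open>\<rho> ^ d\<close>. At scales \<open>r > \<eta>\<close>
  the measure then resembles Lebesgue measure down to the spacing \<open>\<rho>\<close> and a single cube below it;
  at scales \<open>r \<le> \<eta>\<close> it has density \<open>\<eta> powr (\<alpha> - d)\<close> up to boundedly many overlaps.
\<close>

lemma frostman_exponent_inequality:
  fixes \<eta> \<rho> r \<alpha> A :: real
  assumes "0 < \<eta>" "0 < \<rho>" "0 < r" "r < 1" "\<eta> \<le> 1" "0 \<le> \<alpha>" "\<alpha> \<le> real d" "1 \<le> A" "\<eta> powr \<alpha> \<le> A * \<rho> ^ d"
  shows "\<eta> powr (\<alpha> - real d) * ((2 * (r + \<eta>) / \<rho> + 2) ^ d * (min \<eta> (2 * r)) ^ d) \<le> 12 ^ d * A * r powr \<alpha>"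
proof -
  have eta_d: "\<eta> powr (\<alpha> - real d) * \<eta> ^ d = \<eta> powr \<alpha>"
    using assms by (simp add: powr_diff powr_realpow)
  have count: "(2 * (r + \<eta>) / \<rho> + 2) ^ d \<le> 6 ^ d * (if 1 \<le> s / \<rho> then s ^ d / \<rho> ^ d else 1)"
    if s: "r \<le> s" "\<eta> \<le> s" for s
  proof -
    have "2 * (r + \<eta>) / \<rho> \<le> 4 * (s / \<rho>)"
      using s assms by (simp add: divide_right_mono)
    then have "2 * (r + \<eta>) / \<rho> + 2 \<le> 6 * (if 1 \<le> s / \<rho> then s / \<rho> else 1)"
      by (cases "1 \<le> s / \<rho>") simp_all
    then have "(2 * (r + \<eta>) / \<rho> + 2) ^ d \<le> (6 * (if 1 \<le> s / \<rho> then s / \<rho> else 1)) ^ d"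
      using assms by (intro power_mono) simp_all
    then show ?thesis
      by (simp add: power_mult_distrib power_divide split: if_splits)
  qed
  have eta_alpha: "\<eta> ^ d \<le> \<eta> powr \<alpha>"
    using assms by (simp add: powr_mono' flip: powr_realpow)
  have r_alpha: "r ^ d \<le> r powr \<alpha>"
    using assms by (simp add: powr_mono' flip: powr_realpow)
  show ?thesis
  proof (cases "r \<le> \<eta>")
    case True
    have "\<eta> powr (\<alpha> - real d) * r ^ d \<le> r powr (\<alpha> - real d) * r ^ d"
      using True assms by (intro mult_right_mono powr_mono2') auto
    also have "\<dots> = r powr \<alpha>"
      using assms by (simp add: powr_diff powr_realpow)
    finally have 1: "\<eta> powr (\<alpha> - real d) * (min \<eta> (2 * r)) ^ d \<le> 2 ^ d * r powr \<alpha>"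
    proof -
      assume *: "\<eta> powr (\<alpha> - real d) * r ^ d \<le> r powr \<alpha>"
      have "\<eta> powr (\<alpha> - real d) * (min \<eta> (2 * r)) ^ d \<le> \<eta> powr (\<alpha> - real d) * (2 * r) ^ d"
        using assms by (intro mult_left_mono power_mono) auto
      also have "\<dots> = 2 ^ d * (\<eta> powr (\<alpha> - real d) * r ^ d)"
        by (simp add: power_mult_distrib)
      also have "\<dots> \<le> 2 ^ d * r powr \<alpha>"
        using * by (intro mult_left_mono) auto
      finally show ?thesis .
    qed
    have "(if 1 \<le> \<eta> / \<rho> then \<eta> ^ d / \<rho> ^ d else 1) \<le> A"
      using eta_alpha assms by (auto simp: divide_le_eq)
    then have 2: "(2 * (r + \<eta>) / \<rho> + 2) ^ d \<le> 6 ^ d * A"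
      using count[of \<eta>] True by (smt (verit) mult_left_mono zero_less_power)
    have "((2 * (r + \<eta>) / \<rho> + 2) ^ d) * (\<eta> powr (\<alpha> - real d) * (min \<eta> (2 * r)) ^ d)
        \<le> (6 ^ d * A) * (2 ^ d * r powr \<alpha>)"
      using assms by (intro mult_mono 1 2) auto
    also have "\<dots> = 12 ^ d * A * r powr \<alpha>"
      using power_mult_distrib[of "6::real" 2 d] by simp
    finally show ?thesis by (simp add: mult_ac)
  next
    case False
    have 1: "\<eta> powr (\<alpha> - real d) * (min \<eta> (2 * r)) ^ d \<le> \<eta> powr \<alpha>"
      unfolding eta_d[symmetric] using assms by (intro mult_left_mono power_mono) auto
    have 2: "\<eta> powr \<alpha> * (if 1 \<le> r / \<rho> then r ^ d / \<rho> ^ d else 1) \<le> A * r powr \<alpha>"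
    proof (cases "1 \<le> r / \<rho>")
      case True
      have "\<eta> powr \<alpha> * (r ^ d / \<rho> ^ d) \<le> (A * \<rho> ^ d) * (r ^ d / \<rho> ^ d)"
        using assms by (intro mult_right_mono) auto
      also have "\<dots> = A * r ^ d" using assms by simp
      also have "\<dots> \<le> A * r powr \<alpha>" using assms r_alpha by (intro mult_left_mono) auto
      finally show ?thesis using True by simp
    next
      case no: False
      show ?thesis
      proof (cases "0 \<le> \<alpha>")
        case True
        have "\<eta> powr \<alpha> \<le> r powr \<alpha>" using assms False True by (intro powr_mono2) auto
        also have "\<dots> \<le> A * r powr \<alpha>" using assms by simp
        finally show ?thesis using no by simp
      qed (use assms in auto)
    qed
    have "(2 * (r + \<eta>) / \<rho> + 2) ^ d * (\<eta> powr (\<alpha> - real d) * (min \<eta> (2 * r)) ^ d)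
        \<le> (6 ^ d * (if 1 \<le> r / \<rho> then r ^ d / \<rho> ^ d else 1)) * \<eta> powr \<alpha>"
      using assms False by (intro mult_mono 1 count) auto
    also have "\<dots> \<le> 6 ^ d * (A * r powr \<alpha>)"
      using 2 by (simp add: mult_ac)
    also have "\<dots> \<le> 12 ^ d * (A * r powr \<alpha>)"
      using assms by (intro mult_right_mono power_mono) auto
    finally show ?thesis by (simp add: mult_ac)
  qed
qed

text \<open>
  A ball of radius \<open>r\<close> meets the cubes at those lattice translates of points of \<open>Y\<close> that lie within
  \<open>r + \<eta>\<close> of its centre. Separation bounds their number, and each contributes at most the volume
  of an intersection of two cubes of sides \<open>\<eta>\<close> and \<open>2 * r\<close>.
\<close>

lemma frostman_cubes_measure:
  fixes Y :: "(real ^ 'n::finite) set" and \<eta> \<rho> \<alpha> A :: real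
  assumes "finite Y" and "0 < \<rho>" and "0 < \<eta>" and "\<eta> \<le> 1"
    and "0 \<le> \<alpha>" and "\<alpha> \<le> real CARD('n)" and "1 \<le> A"
    and content: "\<eta> powr \<alpha> \<le> A * \<rho> ^ CARD('n)"
    and sep: "\<And>y y' m. y \<in> Y \<Longrightarrow> y' \<in> Y \<Longrightarrow> m \<in> int_lattice \<Longrightarrow> y + m \<noteq> y' \<Longrightarrow>
      \<exists>i. \<rho> \<le> \<bar>(y + m - y') $ i\<bar>"
    and inj: "\<And>y y'. y \<in> Y \<Longrightarrow> y' \<in> Y \<Longrightarrow> y - y' \<in> int_lattice \<Longrightarrow> y = y'"
  shows "frostman \<alpha> (12 ^ CARD('n) * A) (cubes_measure (\<eta> powr (\<alpha> - real CARD('n))) \<eta> Y)"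
  unfolding frostman_def
proof (intro conjI allI impI)
  show "sets (cubes_measure (\<eta> powr (\<alpha> - real CARD('n))) \<eta> Y) = sets borel"
    by (simp add: cubes_measure_def)
next
  fix x :: "'n torus" and r :: real
  assume "0 < r \<and> r < 1"
  then have r: "0 < r" "r < 1" by auto
  define x0 where "x0 = rep_torus x"
  \<comment> \<open>The translates of points of \<open>Y\<close> that matter, and those belonging to a given \<open>y\<close>.
    As \<open>Y\<close> is injective modulo the lattice, the latter sets are disjoint.\<close>
  define F where "F = {w. (\<exists>y\<in>Y. w - y \<in> int_lattice) \<and> (\<forall>i. \<bar>w $ i - x0 $ i\<bar> \<le> r + \<eta>)}"
  define F' where "F' y = {w \<in> F. w - y \<in> int_lattice}" for y
  define V where "V = (min \<eta> (2 * r)) ^ CARD('n)"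
  let ?c = "\<eta> powr (\<alpha> - real CARD('n))"
  have "0 \<le> V" using assms r by (simp add: V_def)
  have F_sep: "\<exists>i. \<rho> \<le> \<bar>w $ i - w' $ i\<bar>" if "w \<in> F" "w' \<in> F" "w \<noteq> w'" for w w'
  proof -
    obtain y y' where y: "y \<in> Y" "w - y \<in> int_lattice" "y' \<in> Y" "w' - y' \<in> int_lattice"
      using \<open>w \<in> F\<close> \<open>w' \<in> F\<close> by (auto simp: F_def)
    have "(w - y) - (w' - y') \<in> int_lattice"
      by (rule int_lattice_diff[OF y(2) y(4)])
    then have "\<exists>i. \<rho> \<le> \<bar>(y + ((w - y) - (w' - y')) - y') $ i\<bar>"
      using y that by (intro sep) auto
    then show ?thesis by simp
  qed
  have F_near: "\<And>w i. w \<in> F \<Longrightarrow> \<bar>w $ i - x0 $ i\<bar> \<le> r + \<eta>"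
    by (simp add: F_def)
  have F: "finite F" "real (card F) \<le> (2 * (r + \<eta>) / \<rho> + 2) ^ CARD('n)"
    using card_separated_points[of \<rho> "r + \<eta>" F x0] F_sep F_near assms r by auto
  have piece: "emeasure lborel (cbox y (y + vec \<eta>) \<inter> torus_proj -` ball x r) \<le> ennreal (real (card (F' y)) * V)"
    if "y \<in> Y" for y
  proof -
    define Q where "Q w = cbox y (y + vec \<eta>) \<inter> cbox (x0 - (w - y) - vec r) (x0 - (w - y) + vec r)" for w
    have "cbox y (y + vec \<eta>) \<inter> torus_proj -` ball x r \<subseteq> (\<Union>w\<in>F' y. Q w)"
    proof
      fix u assume u: "u \<in> cbox y (y + vec \<eta>) \<inter> torus_proj -` ball x r"
      then obtain m where m: "m \<in> int_lattice" "norm (x0 - (u + m)) < r"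
        using torus_proj_in_ball[of u x r] by (auto simp: x0_def)
      have u_y: "y $ i \<le> u $ i" "u $ i \<le> y $ i + \<eta>" for i
        using u by (auto simp: mem_box_cart)
      have u_x: "\<bar>x0 $ i - (u $ i + m $ i)\<bar> < r" for i
        using m(2) component_le_norm_cart[of "x0 - (u + m)" i] by simp
      have "\<bar>y $ i + m $ i - x0 $ i\<bar> \<le> r + \<eta>" for i
        using u_y[of i] u_x[of i] by linarith
      then have "y + m \<in> F' y"
        using \<open>y \<in> Y\<close> m by (auto simp: F'_def F_def intro!: bexI[of _ y])
      moreover have "u \<in> Q (y + m)"
      proof -
        have "x0 $ i - m $ i - r \<le> u $ i \<and> u $ i \<le> x0 $ i - m $ i + r" for i
          using u_x[of i] by linarith
        then show ?thesis using u by (simp add: Q_def mem_box_cart)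
      qed
      ultimately show "u \<in> (\<Union>w\<in>F' y. Q w)" by blast
    qed
    then have "emeasure lborel (cbox y (y + vec \<eta>) \<inter> torus_proj -` ball x r) \<le> emeasure lborel (\<Union>w\<in>F' y. Q w)"
      by (rule emeasure_mono) (use F in \<open>auto simp: Q_def F'_def\<close>)
    also have "\<dots> \<le> (\<Sum>w\<in>F' y. emeasure lborel (Q w))"
      by (rule emeasure_subadditive_finite) (use F in \<open>auto simp: Q_def F'_def\<close>)
    also have "\<dots> \<le> (\<Sum>w\<in>F' y. ennreal V)"
    proof (rule sum_mono)
      fix w
      define z where "z = x0 - (w - y) - vec r"
      have "emeasure lborel (Q w) \<le> emeasure lborel (cbox y (y + vec \<eta>))"
        by (rule emeasure_mono) (auto simp: Q_def)
      then have 1: "emeasure lborel (Q w) \<le> ennreal (\<eta> ^ CARD('n))"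
        using assms by (simp add: emeasure_cube)
      have "x0 - (w - y) + vec r = z + vec (2 * r)"
        by (simp add: z_def vec_eq_iff)
      then have "emeasure lborel (Q w) \<le> emeasure lborel (cbox z (z + vec (2 * r)))"
        unfolding Q_def z_def[symmetric] by (intro emeasure_mono) auto
      then have 2: "emeasure lborel (Q w) \<le> ennreal ((2 * r) ^ CARD('n))"
        using r by (subst (asm) emeasure_cube) auto
      from 1 2 show "emeasure lborel (Q w) \<le> ennreal V"
        by (auto simp: V_def min_def)
    qed
    also have "\<dots> = ennreal (real (card (F' y)) * V)"
      using \<open>0 \<le> V\<close> by (simp add: ennreal_mult ennreal_of_nat_eq_real_of_nat)
    finally show ?thesis .
  qed
  have "(\<Sum>y\<in>Y. card (F' y)) = card (\<Union>y\<in>Y. F' y)"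
  proof (rule card_UN_disjoint[symmetric])
    show "\<forall>y\<in>Y. \<forall>y'\<in>Y. y \<noteq> y' \<longrightarrow> F' y \<inter> F' y' = {}"
    proof (intro ballI impI, rule ccontr)
      fix y y' assume y: "y \<in> Y" "y' \<in> Y" "y \<noteq> y'" "F' y \<inter> F' y' \<noteq> {}"
      then obtain w where "w - y \<in> int_lattice" "w - y' \<in> int_lattice" by (auto simp: F'_def)
      then have "(w - y') - (w - y) \<in> int_lattice" by (metis int_lattice_diff)
      then show False using inj y by simp
    qed
  qed (use assms F in \<open>auto simp: F'_def\<close>)
  also have "\<dots> \<le> card F"
    using F by (intro card_mono) (auto simp: F'_def)
  finally have total: "(\<Sum>y\<in>Y. card (F' y)) \<le> card F" .
  have "emeasure (cubes_measure ?c \<eta> Y) (ball x r)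
      \<le> (\<Sum>y\<in>Y. ennreal ?c * ennreal (real (card (F' y)) * V))"
    unfolding emeasure_cubes_measure[OF borel_open[OF open_ball]]
    by (intro sum_mono mult_left_mono piece) auto
  also have "\<dots> = ennreal (\<Sum>y\<in>Y. ?c * (real (card (F' y)) * V))"
    using \<open>0 \<le> V\<close> by (simp add: ennreal_mult' sum_nonneg flip: sum_ennreal)
  also have "(\<Sum>y\<in>Y. ?c * (real (card (F' y)) * V)) = ?c * (real (\<Sum>y\<in>Y. card (F' y)) * V)"
    by (simp add: sum_distrib_left sum_distrib_right)
  also have "\<dots> \<le> ?c * (real (card F) * V)"
    using total \<open>0 \<le> V\<close> by (intro mult_left_mono mult_right_mono of_nat_mono) auto
  also have "\<dots> \<le> ?c * ((2 * (r + \<eta>) / \<rho> + 2) ^ CARD('n) * V)"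
    using F \<open>0 \<le> V\<close> by (intro mult_left_mono mult_right_mono) auto
  also have "\<dots> \<le> 12 ^ CARD('n) * A * r powr \<alpha>"
    unfolding V_def using assms r by (intro frostman_exponent_inequality) auto
  finally show "emeasure (cubes_measure ?c \<eta> Y) (ball x r) \<le> ennreal (12 ^ CARD('n) * A * r powr \<alpha>)"
    by (simp add: ennreal_leI)
qed


section \<open>Sums of characters\<close>

text \<open>
  Lebesgue measure on \<open>real ^ 'n\<close> is by construction the image of a product measure indexed by
  the standard basis; the work is in passing from basis vectors back to coordinates.
\<close>

lemma lborel_integral_prod_vec:
  fixes g :: "'n::finite \<Rightarrow> real \<Rightarrow> complex"
  assumes g: "\<And>i. integrable lborel (g i)"
  shows "(LINT u|lborel. (\<Prod>i\<in>UNIV. g i (u $ i))) = (\<Prod>i\<in>UNIV. LINT t|lborel. g i t)"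
proof -
  interpret product_sigma_finite "\<lambda>b :: real ^ 'n. interval_measure (\<lambda>x. x)"
    by (simp add: lborel_eq_real[symmetric] product_sigma_finite_def sigma_finite_lborel)
  define h where "h b = g (SOME i. b = axis i 1)" for b :: "real ^ 'n"
  have h: "h (axis i 1) = g i" for i
    by (simp add: h_def axis_eq_axis)
  have basis: "(\<Prod>b\<in>(Basis :: (real ^ 'n) set). F b) = (\<Prod>i\<in>UNIV. F (axis i 1))" for F :: "real ^ 'n \<Rightarrow> complex"
  proof -
    have inj: "inj (\<lambda>i :: 'n. axis i (1::real))" by (simp add: inj_def axis_eq_axis)
    have basis_eq: "(Basis :: (real ^ 'n) set) = range (\<lambda>i. axis i 1)" by (auto simp: Basis_vec_def)
    then show ?thesis
      by (simp only: basis_eq) (simp add: prod.reindex[OF inj])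
  qed
  have [measurable]: "g i \<in> borel_measurable borel" for i
    using g[of i] by auto
  have coord: "(\<Sum>b\<in>Basis. f b *\<^sub>R b) $ i = f (axis i 1)" for f :: "real ^ 'n \<Rightarrow> real" and i
  proof -
    have "(\<Sum>b\<in>Basis. f b *\<^sub>R b) $ i = (\<Sum>b\<in>Basis. f b *\<^sub>R b) \<bullet> axis i 1"
      by (simp add: inner_axis)
    also have "\<dots> = f (axis i 1)"
      by (subst inner_sum_left_Basis) (auto simp: axis_in_Basis_iff)
    finally show ?thesis .
  qed
  have "(LINT u|lborel. (\<Prod>i\<in>UNIV. g i (u $ i)))
      = (LINT f|(\<Pi>\<^sub>M b\<in>Basis. interval_measure (\<lambda>x. x)). (\<Prod>i\<in>UNIV. g i ((\<Sum>b\<in>Basis. f b *\<^sub>R b) $ i)))"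
    unfolding lborel_def by (subst integral_distr) simp_all
  also have "\<dots> = (LINT f|(\<Pi>\<^sub>M b\<in>Basis. interval_measure (\<lambda>x. x)). (\<Prod>b\<in>Basis. h b (f b)))"
    unfolding coord by (simp add: basis h)
  also have "\<dots> = (\<Prod>b\<in>Basis. LINT t|interval_measure (\<lambda>x. x). h b t)"
    using g by (intro product_integral_prod) (auto simp: h_def simp flip: lborel_eq_real)
  also have "\<dots> = (\<Prod>i\<in>UNIV. LINT t|lborel. g i t)"
    by (simp add: basis h lborel_eq_real)
  finally show ?thesis .
qed

lemma integral_unit_interval_exp:
  fixes k :: int
  defines "e \<equiv> \<lambda>t::real. exp (2 * pi * \<i> * of_real (of_int k * t))"
  shows "integrable lborel (\<lambda>t. indicator {0..1} t *\<^sub>R e t)"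
    and "(LINT t|lborel. indicator {0..1} t *\<^sub>R e t) = (if k = 0 then 1 else 0)"
proof -
  have cont: "continuous_on {0..1} e"
    unfolding e_def by (intro continuous_intros)
  then show "integrable lborel (\<lambda>t. indicator {0..1} t *\<^sub>R e t)"
    by (intro borel_integrable_compact) auto
  show "(LINT t|lborel. indicator {0..1} t *\<^sub>R e t) = (if k = 0 then 1 else 0)"
  proof (cases "k = 0")
    case True
    then show ?thesis by (simp add: e_def)
  next
    case False
    define c where "c = 2 * pi * \<i> * of_int k"
    have "c \<noteq> 0" using False by (simp add: c_def)
    have "((\<lambda>t. exp (c * of_real t) / c) has_vector_derivative e t) (at t within {0..1})" for t
    proof -
      have "((\<lambda>z. exp (c * z) / c) has_field_derivative exp (c * of_real t)) (at (of_real t))"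
        using \<open>c \<noteq> 0\<close> by (auto intro!: derivative_eq_intros)
      then have "((\<lambda>t. exp (c * of_real t) / c) has_vector_derivative exp (c * of_real t)) (at t within {0..1})"
        by (intro has_vector_derivative_real_field)
      then show ?thesis by (simp add: e_def c_def mult_ac)
    qed
    then have "(LINT t|lborel. indicator {0..1} t *\<^sub>R e t) = exp (c * of_real 1) / c - exp (c * of_real 0) / c"
      by (intro integral_FTC_atLeastAtMost cont) auto
    moreover have "exp c = 1"
      using exp_integer_2pi[of "of_int k"] by (simp add: c_def mult_ac)
    ultimately show ?thesis using False by simp
  qed
qed

lemma character_torus_proj:
  "character n (torus_proj u) = exp (2 * pi * \<i> * of_real (of_int_vec n \<bullet> u))"
  by (rule character.abs_eq)

lemma continuous_on_character_proj:
  "continuous_on A (\<lambda>u. character n (torus_proj u))"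
  unfolding character_torus_proj by (intro continuous_intros)

lemma integral_character:
  fixes n :: "int ^ 'n::finite"
  shows "(LINT u : cbox 0 1 | lborel. character n (torus_proj u)) = (if n = 0 then 1 else 0)"
proof -
  define g where "g i t = indicator {0..1} t *\<^sub>R exp (2 * pi * \<i> * of_real (of_int (n $ i) * t))" for i and t :: real
  have integrable: "integrable lborel (g i)" for i
    unfolding g_def by (rule integral_unit_interval_exp(1))
  have expand: "indicator (cbox 0 1) u *\<^sub>R character n (torus_proj u) = (\<Prod>i\<in>UNIV. g i (u $ i))" for u
  proof -
    have "(indicator (cbox 0 1) u :: real) = (\<Prod>i\<in>UNIV. indicator {0..1} (u $ i))"
      by (auto simp: indicator_def mem_box_cart)
    moreover have "character n (torus_proj u) = (\<Prod>i\<in>UNIV. exp (2 * pi * \<i> * of_real (of_int (n $ i) * u $ i)))"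
      by (simp add: character_torus_proj inner_vec_def of_int_vec_def sum_distrib_left flip: exp_sum)
    ultimately show ?thesis
      by (simp add: g_def scaleR_conv_of_real prod.distrib)
  qed
  have "(LINT u : cbox 0 1 | lborel. character n (torus_proj u)) = (\<Prod>i\<in>UNIV. LINT t|lborel. g i t)"
    unfolding set_lebesgue_integral_def expand by (rule lborel_integral_prod_vec[OF integrable])
  also have "\<dots> = (\<Prod>i\<in>UNIV. if n $ i = 0 then 1 else 0)"
    unfolding g_def integral_unit_interval_exp(2) ..
  also have "\<dots> = (if n = 0 then 1 else 0)"
    by (auto simp: vec_eq_iff)
  finally show ?thesis .
qed

lemma character_diff: "character (n - m) x = character n x * cnj (character m x)"
proof transfer
  fix n m :: "int ^ 'n" and x :: "real ^ 'n"
  have "of_int_vec (n - m) \<bullet> x = of_int_vec n \<bullet> x - of_int_vec m \<bullet> x"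
    by (simp add: of_int_vec_def inner_vec_def left_diff_distrib sum_subtractf)
  then show "exp (2 * pi * \<i> * of_real (of_int_vec (n - m) \<bullet> x))
      = exp (2 * pi * \<i> * of_real (of_int_vec n \<bullet> x)) * cnj (exp (2 * pi * \<i> * of_real (of_int_vec m \<bullet> x)))"
    by (simp add: exp_cnj right_diff_distrib flip: exp_add)
qed

lemma fourier_coeff_sum_characters:
  fixes A :: "(int ^ 'n::finite) set"
  assumes "finite A"
  shows "fourier_coeff (\<lambda>x. \<Sum>n\<in>A. character n x) m = (if m \<in> A then 1 else 0)"
proof -
  have "fourier_coeff (\<lambda>x. \<Sum>n\<in>A. character n x) m
      = (LINT u|lborel. (\<Sum>n\<in>A. indicator (cbox 0 1) u *\<^sub>R character (n - m) (torus_proj u)))"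
    by (simp add: fourier_coeff_def set_lebesgue_integral_def character_diff sum_distrib_right scaleR_sum_right)
  also have "\<dots> = (\<Sum>n\<in>A. LINT u|lborel. indicator (cbox 0 1) u *\<^sub>R character (n - m) (torus_proj u))"
    by (intro Bochner_Integration.integral_sum borel_integrable_compact continuous_on_character_proj) auto
  also have "\<dots> = (\<Sum>n\<in>A. if n = m then 1 else 0)"
    using integral_character[where 'n = 'n] by (intro sum.cong) (simp_all add: set_lebesgue_integral_def)
  also have "\<dots> = (if m \<in> A then 1 else 0)"
    using assms by simp
  finally show ?thesis .
qed

lemma infsum_indicator_coeff:
  fixes F :: "'a \<Rightarrow> 'b::{t2_space, comm_monoid_add}"
  assumes "finite A" and "\<And>n. n \<notin> A \<Longrightarrow> F n = 0"
  shows "(\<Sum>\<^sub>\<infinity>n. F n) = sum F A"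
proof -
  have "(\<Sum>\<^sub>\<infinity>n. F n) = (\<Sum>\<^sub>\<infinity>n\<in>A. F n)"
    by (rule infsum_cong_neutral) (use assms in auto)
  with assms show ?thesis by simp
qed

lemma trig_polynomial_sum_characters:
  assumes "finite A"
  shows "trig_polynomial (\<lambda>x. \<Sum>n\<in>A. character n x)"
  unfolding trig_polynomial_def fourier_coeff_sum_characters[OF assms]
  using assms by (auto simp: infsum_indicator_coeff[of A])

lemma sobolev_norm_sum_characters:
  fixes A :: "(int ^ 'n::finite) set"
  assumes "finite A"
  shows "sobolev_norm s (\<lambda>x. \<Sum>n\<in>A. character n x)
    = sqrt (\<Sum>n\<in>A. (1 + (norm (of_int_vec n :: real ^ 'n))\<^sup>2) powr s)"
  unfolding sobolev_norm_def fourier_coeff_sum_characters[OF assms]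
  using assms by (simp add: infsum_indicator_coeff[of A])

lemma propagator_sum_characters:
  fixes A :: "(int ^ 'n::finite) set"
  assumes "finite A"
  shows "propagator P t (\<lambda>x. \<Sum>n\<in>A. character n x) x
    = (\<Sum>n\<in>A. character n x * exp (2 * pi * \<i> * of_real (of_int (mpoly_eval P n) * t)))"
  unfolding propagator_def fourier_coeff_sum_characters[OF assms]
  using assms by (simp add: infsum_indicator_coeff[of A])


section \<open>Refocusing of a progression of frequencies\<close>

text \<open>
  The frequencies of the test function: a cube in the shifted lattice \<open>a + p \<int>\<^sup>d\<close>.
\<close>

definition progression :: "nat \<Rightarrow> nat \<Rightarrow> int ^ 'n \<Rightarrow> (int ^ 'n) set" where
  "progression p L a = (\<lambda>m. a + int p *s m) ` {m. \<forall>i. m $ i \<in> {0..<int L}}"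

lemma finite_progression: "finite (progression p L (a :: int ^ 'n::finite))"
  by (simp only: progression_def finite_imageI vec_box_card(1) finite_atLeastLessThan_int)

lemma card_progression:
  assumes "0 < p"
  shows "card (progression p L (a :: int ^ 'n::finite)) = L ^ CARD('n)"
proof -
  have "inj_on (\<lambda>m. a + int p *s m) {m. \<forall>i. m $ i \<in> {0..<int L}}"
    using assms by (auto simp: inj_on_def vec_eq_iff)
  then show ?thesis
    using vec_box_card(2)[of "{0..<int L}", where 'n = 'n] by (simp add: progression_def card_image)
qed

lemma progression_bounds:
  assumes "n \<in> progression p L a" and "\<And>i. 0 \<le> a $ i \<and> a $ i < int p"
  shows "0 \<le> n $ i" and "n $ i \<le> int (p * L)"
proof -
  obtain m where m: "n = a + int p *s m" "m $ i \<in> {0..<int L}"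
    using assms(1) by (auto simp: progression_def)
  have a: "0 \<le> a $ i" "a $ i < int p" using assms(2) by auto
  show "0 \<le> n $ i" using m a by simp
  have "int p * m $ i \<le> int p * (int L - 1)"
    using m by (intro mult_left_mono) auto
  then show "n $ i \<le> int (p * L)" using m a by (simp add: right_diff_distrib)
qed

lemma norm_sum_close_phases:
  fixes \<theta> :: real and \<epsilon> :: "'a \<Rightarrow> real"
  assumes "\<And>n. n \<in> A \<Longrightarrow> z n = exp (2 * pi * \<i> * of_real (\<theta> + of_int (k n) + \<epsilon> n))"
    and "\<And>n. n \<in> A \<Longrightarrow> 0 \<le> \<epsilon> n" and "\<And>n. n \<in> A \<Longrightarrow> \<epsilon> n \<le> 1 / 6"
  shows "real (card A) / 2 \<le> cmod (\<Sum>n\<in>A. z n)"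
proof -
  have z: "z n = exp (2 * pi * \<i> * of_real \<theta>) * cis (2 * pi * \<epsilon> n)" if "n \<in> A" for n
  proof -
    have "exp (2 * pi * \<i> * of_real (\<theta> + of_int (k n) + \<epsilon> n))
        = exp (2 * pi * \<i> * of_real \<theta>) * exp (2 * of_real pi * \<i> * of_int (k n)) * cis (2 * pi * \<epsilon> n)"
      by (simp add: cis_conv_exp ring_distribs mult_ac add_ac flip: exp_add)
    then show ?thesis
      using assms(1)[OF that] exp_integer_2pi[of "of_int (k n)"] by (simp add: mult_ac)
  qed
  have "1 / 2 \<le> cos (2 * pi * \<epsilon> n)" if "n \<in> A" for n
  proof -
    have "2 * pi * \<epsilon> n \<le> 2 * pi * (1 / 6)"
      using assms(3)[OF that] by (intro mult_left_mono) auto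
    then have "cos (pi / 3) \<le> cos (2 * pi * \<epsilon> n)"
      using assms(2)[OF that] by (intro cos_monotone_0_pi_le) auto
    then show ?thesis by (simp add: cos_60)
  qed
  then have "(\<Sum>n\<in>A. 1 / 2) \<le> (\<Sum>n\<in>A. cos (2 * pi * \<epsilon> n))"
    by (intro sum_mono)
  then have "real (card A) / 2 \<le> Re (\<Sum>n\<in>A. cis (2 * pi * \<epsilon> n))"
    by (simp add: Re_sum)
  also have "\<dots> \<le> cmod (\<Sum>n\<in>A. cis (2 * pi * \<epsilon> n))"
    by (rule complex_Re_le_cmod)
  also have "\<dots> = cmod (\<Sum>n\<in>A. z n)"
    by (simp add: z norm_mult flip: sum_distrib_left)
  finally show ?thesis .
qed

text \<open>
  For \<open>n = a + p m\<close> the Taylor expansion modulo \<open>p\<^sup>2\<close> gives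
  \<open>P(n) j / p\<^sup>2 \<equiv> P(a) j / p\<^sup>2 + j (v \<bullet> m) / p\<close> modulo \<open>1\<close>, while
  \<open>n \<bullet> W / p\<^sup>2 = a \<bullet> W / p\<^sup>2 + m \<bullet> W / p\<close>. Since \<open>W + j v\<close> is divisible by \<open>p\<close>, the terms
  depending on \<open>m\<close> add up to an integer: at \<open>x = W / p\<^sup>2\<close> and \<open>t = j / p\<^sup>2\<close> all summands have
  the same phase. Moving \<open>x\<close> by at most \<open>1 / (6 d p L)\<close> in each coordinate changes the phases by at
  most a sixth of a turn, so no more than half of the sum is lost.
\<close>

lemma propagator_refocuses:
  fixes P :: "'n::finite int_mpoly" and a v W :: "int ^ 'n" and u :: "real ^ 'n"
  assumes p: "0 < p" and L: "0 < L"
    and a: "\<And>i. 0 \<le> a $ i \<and> a $ i < int p"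
    and v: "\<And>i. v $ i = mpoly_eval (mpoly_pderiv i P) a"
    and W: "\<And>i. int p dvd W $ i + j * v $ i"
    and u: "\<And>i. 0 \<le> u $ i - of_int (W $ i) / (real p)\<^sup>2"
      "\<And>i. u $ i - of_int (W $ i) / (real p)\<^sup>2 \<le> 1 / (6 * real CARD('n) * real (p * L))"
  shows "real L ^ CARD('n) / 2 \<le>
    cmod (propagator P (of_int j / (real p)\<^sup>2) (\<lambda>x. \<Sum>n\<in>progression p L a. character n x) (torus_proj u))"
proof -
  define t where "t = of_int j / (real p)\<^sup>2"
  define w where "w i = of_int (W $ i) / (real p)\<^sup>2" for i
  define \<theta> where "\<theta> = (\<Sum>i\<in>UNIV. of_int (a $ i) * w i) + of_int (mpoly_eval P a) * t"
  define \<epsilon> where "\<epsilon> n = (\<Sum>i\<in>UNIV. of_int (n $ i) * (u $ i - w i))" for n :: "int ^ 'n"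
  have "\<exists>k :: int. of_int_vec n \<bullet> u + of_int (mpoly_eval P n) * t = \<theta> + of_int k + \<epsilon> n"
    if n: "n \<in> progression p L a" for n
  proof -
    obtain m where m: "n = a + int p *s m" using n by (auto simp: progression_def)
    obtain c where c: "W $ i + j * v $ i = int p * c i" for i
      using W unfolding dvd_def by metis
    obtain h where h: "mpoly_eval P n - mpoly_eval P a - int p * (\<Sum>i\<in>UNIV. v $ i * m $ i) = (int p)\<^sup>2 * h"
      using mpoly_eval_taylor_mod_square[of "int p" P a m] unfolding m v dvd_def by metis
    define k where "k = (\<Sum>i\<in>UNIV. m $ i * c i) + h * j"
    have "mpoly_eval P n = mpoly_eval P a + int p * (\<Sum>i\<in>UNIV. v $ i * m $ i) + (int p)\<^sup>2 * h"
      using h by linarith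
    then have "of_int (mpoly_eval P n) = (of_int (mpoly_eval P a + int p * (\<Sum>i\<in>UNIV. v $ i * m $ i) + (int p)\<^sup>2 * h) :: real)"
      by (simp only:)
    then have Pn: "of_int (mpoly_eval P n) * t = of_int (mpoly_eval P a) * t
        + real p * t * (\<Sum>i\<in>UNIV. of_int (v $ i) * of_int (m $ i)) + of_int (h * j)"
      using p by (simp add: t_def field_simps)
    have "real p * (w i + t * of_int (v $ i)) = of_int (c i)" for i
    proof -
      have "(of_int (W $ i + j * v $ i) :: real) = of_int (int p * c i)" by (simp only: c)
      then show ?thesis using p by (simp add: w_def t_def field_simps power2_eq_square)
    qed
    then have "(\<Sum>i\<in>UNIV. of_int (m $ i) * (real p * (w i + t * of_int (v $ i)))) = of_int (\<Sum>i\<in>UNIV. m $ i * c i)"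
      by simp
    moreover have "(\<Sum>i\<in>UNIV. of_int (m $ i) * (real p * (w i + t * of_int (v $ i))))
        = (\<Sum>i\<in>UNIV. real p * of_int (m $ i) * w i) + real p * t * (\<Sum>i\<in>UNIV. of_int (v $ i) * of_int (m $ i))"
      by (simp add: sum_distrib_left sum.distrib ring_distribs mult_ac)
    ultimately have mc: "(\<Sum>i\<in>UNIV. real p * of_int (m $ i) * w i)
        + real p * t * (\<Sum>i\<in>UNIV. of_int (v $ i) * of_int (m $ i)) = of_int (\<Sum>i\<in>UNIV. m $ i * c i)"
      by simp
    have "of_int_vec n \<bullet> u = (\<Sum>i\<in>UNIV. of_int (n $ i) * w i) + \<epsilon> n"
      by (simp add: of_int_vec_def inner_vec_def \<epsilon>_def flip: sum.distrib) (simp add: algebra_simps)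
    also have "(\<Sum>i\<in>UNIV. of_int (n $ i) * w i) = (\<Sum>i\<in>UNIV. of_int (a $ i) * w i) + (\<Sum>i\<in>UNIV. real p * of_int (m $ i) * w i)"
      by (simp add: m ring_distribs sum.distrib)
    finally have "of_int_vec n \<bullet> u + of_int (mpoly_eval P n) * t = \<theta> + of_int k + \<epsilon> n"
      using Pn mc by (simp add: \<theta>_def k_def)
    then show ?thesis by blast
  qed
  then obtain k where k: "\<And>n. n \<in> progression p L a \<Longrightarrow>
      of_int_vec n \<bullet> u + of_int (mpoly_eval P n) * t = \<theta> + of_int (k n) + \<epsilon> n"
    by metis
  have "real (card (progression p L a)) / 2 \<le> cmod (\<Sum>n\<in>progression p L a.
      character n (torus_proj u) * exp (2 * pi * \<i> * of_real (of_int (mpoly_eval P n) * t)))"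
  proof (rule norm_sum_close_phases)
    fix n assume n: "n \<in> progression p L a"
    show "character n (torus_proj u) * exp (2 * pi * \<i> * of_real (of_int (mpoly_eval P n) * t))
        = exp (2 * pi * \<i> * of_real (\<theta> + of_int (k n) + \<epsilon> n))"
      unfolding k[OF n, symmetric] character_torus_proj
      by (simp add: ring_distribs flip: exp_add)
    have b: "0 \<le> n $ i" "n $ i \<le> int (p * L)" for i
      using progression_bounds[OF n a] by auto
    show "0 \<le> \<epsilon> n"
      unfolding \<epsilon>_def w_def using b u by (intro sum_nonneg mult_nonneg_nonneg) auto
    have "\<epsilon> n \<le> (\<Sum>i\<in>(UNIV :: 'n set). real (p * L) * (1 / (6 * real CARD('n) * real (p * L))))"
      unfolding \<epsilon>_def w_def
    proof (rule sum_mono)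
      fix i
      have "real_of_int (n $ i) \<le> of_int (int (p * L))" using b by (simp only: of_int_le_iff)
      then show "of_int (n $ i) * (u $ i - of_int (W $ i) / (real p)\<^sup>2) \<le> real (p * L) * (1 / (6 * real CARD('n) * real (p * L)))"
        using u[of i] b[of i] by (intro mult_mono) auto
    qed
    also have "\<dots> = 1 / 6" using p L by simp
    finally show "\<epsilon> n \<le> 1 / 6" .
  qed
  then show ?thesis
    by (simp add: propagator_sum_characters[OF finite_progression] card_progression[OF p] t_def)
qed

lemma maximal_function_large:
  fixes P :: "'n::finite int_mpoly" and a v W :: "int ^ 'n" and u :: "real ^ 'n"
  assumes p: "0 < p" and L: "0 < L"
    and a: "\<And>i. 0 \<le> a $ i \<and> a $ i < int p"
    and v: "\<And>i. v $ i = mpoly_eval (mpoly_pderiv i P) a"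
    and W: "W \<in> refocusing_points p v"
    and u: "\<And>i. 0 \<le> u $ i - of_int (W $ i) / (real p)\<^sup>2"
      "\<And>i. u $ i - of_int (W $ i) / (real p)\<^sup>2 \<le> 1 / (6 * real CARD('n) * real (p * L))"
  shows "ennreal (real L ^ CARD('n) / 2) \<le>
    maximal_function P (\<lambda>x. \<Sum>n\<in>progression p L a. character n x) (torus_proj u)"
proof -
  let ?f = "\<lambda>x. \<Sum>n\<in>progression p L a. character n x"
  obtain j where j: "\<And>i. int p dvd W $ i - j * v $ i"
    using W by (auto simp: refocusing_points_def)
  \<comment> \<open>The time has to be positive, and only \<open>j'\<close> modulo \<open>p\<close> matters.\<close>
  define j' where "j' = int p * (\<bar>j\<bar> + 1) - j"
  have "j < 1 * (\<bar>j\<bar> + 1)" by simp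
  also have "\<dots> \<le> int p * (\<bar>j\<bar> + 1)" using p by (intro mult_right_mono) auto
  finally have "0 < j'" by (simp add: j'_def)
  have "int p dvd W $ i + j' * v $ i" for i
  proof -
    have shift: "W $ i + j' * v $ i = (W $ i - j * v $ i) + int p * ((\<bar>j\<bar> + 1) * v $ i)"
      by (simp add: j'_def algebra_simps)
    show ?thesis unfolding shift by (rule dvd_add[OF j]) simp
  qed
  then have "ennreal (real L ^ CARD('n) / 2) \<le> ennreal (cmod (propagator P (of_int j' / (real p)\<^sup>2) ?f (torus_proj u)))"
    by (intro ennreal_leI propagator_refocuses[OF p L a v _ u])
  also have "\<dots> \<le> maximal_function P ?f (torus_proj u)"
    unfolding maximal_function_def using \<open>0 < j'\<close> p by (intro SUP_upper) simp
  finally show ?thesis .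
qed

text \<open>
  The image of the cubes under the projection is compact, hence a Borel set, and \<open>g\<^sup>2\<close> dominates
  \<open>b\<^sup>2\<close> times its indicator.
\<close>

lemma L2_norm_cubes_measure_lower:
  fixes Y :: "(real ^ 'n::finite) set" and g :: "'n torus \<Rightarrow> ennreal"
  assumes "finite Y" and "0 \<le> \<eta>" and "0 \<le> c" and "0 \<le> b" and "0 \<le> B"
    and g: "\<And>y u. y \<in> Y \<Longrightarrow> u \<in> cbox y (y + vec \<eta>) \<Longrightarrow> ennreal b \<le> g (torus_proj u)"
    and norm: "L2_norm (cubes_measure c \<eta> Y) g \<le> ennreal B"
  shows "b\<^sup>2 * (real (card Y) * (c * \<eta> ^ CARD('n))) \<le> B\<^sup>2"
proof -
  let ?\<mu> = "cubes_measure c \<eta> Y"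
  define F where "F = torus_proj ` (\<Union>y\<in>Y. cbox y (y + vec \<eta>))"
  have "compact F"
    unfolding F_def using assms(1) by (intro compact_continuous_image continuous_on_torus_proj compact_UN) auto
  then have F: "F \<in> sets borel"
    by (intro borel_closed compact_imp_closed)
  define I where "I = (\<integral>\<^sup>+x. (g x)\<^sup>2 \<partial>?\<mu>)"
  have "emeasure ?\<mu> F = (\<Sum>y\<in>Y. ennreal c * emeasure lborel (cbox y (y + vec \<eta>)))"
    unfolding emeasure_cubes_measure[OF F]
    by (intro sum.cong refl arg_cong2[where f = "(*)"] arg_cong[where f = "emeasure lborel"]) (auto simp: F_def)
  also have "\<dots> = ennreal (real (card Y) * (c * \<eta> ^ CARD('n)))"
    using assms by (simp add: emeasure_cube ennreal_mult ennreal_of_nat_eq_real_of_nat)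
  finally have mass: "emeasure ?\<mu> F = ennreal (real (card Y) * (c * \<eta> ^ CARD('n)))" .
  have "ennreal (b\<^sup>2 * (real (card Y) * (c * \<eta> ^ CARD('n)))) = (\<integral>\<^sup>+x. ennreal (b\<^sup>2) * indicator F x \<partial>?\<mu>)"
  proof -
    have "F \<in> sets ?\<mu>" using F by (simp add: cubes_measure_def)
    then have "(\<integral>\<^sup>+x. ennreal (b\<^sup>2) * indicator F x \<partial>?\<mu>) = ennreal (b\<^sup>2) * emeasure ?\<mu> F"
      by (rule nn_integral_cmult_indicator)
    also have "\<dots> = ennreal (b\<^sup>2 * (real (card Y) * (c * \<eta> ^ CARD('n))))"
      unfolding mass using assms by (subst ennreal_mult) auto
    finally show ?thesis ..
  qed
  also have "\<dots> \<le> I"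
    unfolding I_def
  proof (rule nn_integral_mono)
    fix x
    show "ennreal (b\<^sup>2) * indicator F x \<le> (g x)\<^sup>2"
    proof (cases "x \<in> F")
      case True
      then have "ennreal b \<le> g x" using g by (auto simp: F_def)
      then have "(ennreal b)\<^sup>2 \<le> (g x)\<^sup>2" by (intro power_mono) auto
      then show ?thesis using True assms by (simp add: ennreal_power)
    qed simp
  qed
  finally have I: "ennreal (b\<^sup>2 * (real (card Y) * (c * \<eta> ^ CARD('n)))) \<le> I" .
  have fin: "I \<noteq> \<infinity>"
    using norm by (auto simp: L2_norm_def I_def[symmetric] Let_def top_unique)
  then have "ennreal (sqrt (enn2real I)) \<le> ennreal B"
    using norm by (simp add: L2_norm_def I_def[symmetric] Let_def)
  then have "sqrt (enn2real I) \<le> B" using \<open>0 \<le> B\<close> by (simp add: ennreal_le_iff)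
  then have "enn2real I \<le> B\<^sup>2" by (simp add: sqrt_le_D)
  moreover have "b\<^sup>2 * (real (card Y) * (c * \<eta> ^ CARD('n))) \<le> enn2real I"
    using I fin assms by (metis enn2real_mono enn2real_ennreal ennreal_neq_top infinity_ennreal_def
        mult_nonneg_nonneg of_nat_0_le_iff top.not_eq_extremum zero_le_power zero_le_power2)
  ultimately show ?thesis by linarith
qed

text \<open>
  All frequencies have length at most \<open>\<surd>d p L\<close>. Passing from \<open>s\<close> to a nonnegative \<open>\<sigma>\<close> gives
  one bound for both signs of \<open>s\<close>.
\<close>

lemma sobolev_norm_progression:
  fixes a :: "int ^ 'n::finite"
  assumes "0 < p" "0 < L" and a: "\<And>i. 0 \<le> a $ i \<and> a $ i < int p" and "s \<le> \<sigma>" "0 \<le> \<sigma>"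
  shows "(sobolev_norm s (\<lambda>x. \<Sum>n\<in>progression p L a. character n x))\<^sup>2
    \<le> (2 * real CARD('n) * (real (p * L))\<^sup>2) powr \<sigma> * real L ^ CARD('n)"
proof -
  define B where "B = 2 * real CARD('n) * (real (p * L))\<^sup>2"
  have term_le: "(1 + (norm (of_int_vec n :: real ^ 'n))\<^sup>2) powr s \<le> B powr \<sigma>" if n: "n \<in> progression p L a" for n
  proof -
    have "(real_of_int (n $ i))\<^sup>2 \<le> (real (p * L))\<^sup>2" for i
    proof (rule power_mono)
      have "real_of_int (n $ i) \<le> of_int (int (p * L))"
        using progression_bounds(2)[OF n a] by (simp only: of_int_le_iff)
      then show "real_of_int (n $ i) \<le> real (p * L)" by simp
      show "0 \<le> real_of_int (n $ i)" using progression_bounds(1)[OF n a] by simp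
    qed
    then have "(\<Sum>i\<in>(UNIV::'n set). (real_of_int (n $ i))\<^sup>2) \<le> (\<Sum>i\<in>(UNIV::'n set). (real (p * L))\<^sup>2)"
      by (intro sum_mono)
    then have "(norm (of_int_vec n :: real ^ 'n))\<^sup>2 \<le> real CARD('n) * (real (p * L))\<^sup>2"
      unfolding power2_norm_eq_inner by (simp add: inner_vec_def of_int_vec_def power2_eq_square)
    moreover have "1 * 1 \<le> real CARD('n) * (real (p * L))\<^sup>2"
    proof (rule mult_mono)
      have "1 \<le> real (p * L)" using assms(1,2) by (metis One_nat_def Suc_leI nat_0_less_mult_iff of_nat_1 of_nat_mono)
      then show "1 \<le> (real (p * L))\<^sup>2" by (rule one_le_power)
      show "1 \<le> real CARD('n)" by (metis One_nat_def one_le_card_finite of_nat_1 of_nat_mono)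
    qed auto
    ultimately have "1 + (norm (of_int_vec n :: real ^ 'n))\<^sup>2 \<le> B" by (simp add: B_def)
    moreover have "(1 + (norm (of_int_vec n :: real ^ 'n))\<^sup>2) powr s \<le> (1 + (norm (of_int_vec n :: real ^ 'n))\<^sup>2) powr \<sigma>"
      using \<open>s \<le> \<sigma>\<close> by (intro powr_mono) auto
    ultimately show ?thesis
      using \<open>0 \<le> \<sigma>\<close> by (meson order_trans powr_mono2 add_nonneg_nonneg zero_le_one zero_le_power2)
  qed
  have "(sobolev_norm s (\<lambda>x. \<Sum>n\<in>progression p L a. character n x))\<^sup>2
      = (\<Sum>n\<in>progression p L a. (1 + (norm (of_int_vec n :: real ^ 'n))\<^sup>2) powr s)"
    by (simp add: sobolev_norm_sum_characters[OF finite_progression] sum_nonneg)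
  also have "\<dots> \<le> (\<Sum>n\<in>progression p L a. B powr \<sigma>)"
    by (intro sum_mono term_le)
  also have "\<dots> = B powr \<sigma> * real L ^ CARD('n)"
    by (simp add: card_progression[OF assms(1)])
  finally show ?thesis by (simp add: B_def)
qed


section \<open>The lower bound\<close>

lemma refocusing_points_separated:
  fixes v W W' k :: "int ^ 'n::finite" and p K :: nat
  assumes p: "prime p" and K: "K \<ge> 1" "K ^ CARD('n) \<le> p"
    and short: "\<And>k :: int ^ 'n. k \<noteq> 0 \<Longrightarrow> (\<And>i. \<bar>k $ i\<bar> \<le> int K) \<Longrightarrow>
      \<not> int p dvd (\<Sum>i\<in>UNIV. k $ i * v $ i)"
    and W: "W \<in> refocusing_points p v" "W' \<in> refocusing_points p v"
    and ne: "W + (int p)\<^sup>2 *s k \<noteq> W'"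
  shows "\<exists>i. real K ^ (CARD('n) - 1) / (4 * real CARD('n)) \<le> real_of_int \<bar>(W + (int p)\<^sup>2 *s k - W') $ i\<bar>"
proof -
  obtain j j' where j: "\<And>i. int p dvd W $ i - j * v $ i" "\<And>i. int p dvd W' $ i - j' * v $ i"
    using W by (auto simp: refocusing_points_def)
  show ?thesis
  proof (rule lattice_vector_large[OF p K short, of _ "j - j'"])
    fix i
    have "(W + (int p)\<^sup>2 *s k - W') $ i - (j - j') * v $ i
        = (W $ i - j * v $ i) - (W' $ i - j' * v $ i) + int p * (int p * k $ i)"
      by (simp add: algebra_simps power2_eq_square)
    then show "int p dvd (W + (int p)\<^sup>2 *s k - W') $ i - (j - j') * v $ i"
      using j by (metis dvd_add dvd_diff dvd_triv_left)
  qed (use ne in auto)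
qed

text \<open>
  The estimate is tested on the progression with \<open>L \<approx> p\<^bsup>\<beta>\<^esup>\<close>. Then the frequencies have size
  \<open>p\<^bsup>1 + \<beta>\<^esup>\<close>, and \<open>(1 + \<beta>) \<alpha> = d + 1\<close> says that \<open>p\<^bsup>d + 1\<^esup>\<close> cubes of side comparable to
  \<open>p\<^bsup>- (1 + \<beta>)\<^esup>\<close>, each of mass \<open>\<eta> powr \<alpha>\<close>, have total mass comparable to \<open>1\<close>. On their union the
  maximal function is at least \<open>L\<^sup>d / 2\<close>, whereas the squared Sobolev norm is
  bounded by \<open>L\<^sup>d\<close> times the power \<open>2 \<sigma>\<close> of the size of the frequencies.
\<close>

lemma estimate_bounds_prime_powers:
  fixes P :: "'n::finite int_mpoly" and \<alpha> s \<sigma> :: real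
  assumes \<alpha>: "0 < \<alpha>" "\<alpha> < real CARD('n)" and P: "mpoly_degree P \<ge> 2" "nonsingular P"
    and est: "fractal_maximal_estimate P \<alpha> s" and \<sigma>: "s \<le> \<sigma>" "0 \<le> \<sigma>"
    and \<beta>: "(1 + \<beta>) * \<alpha> = real CARD('n) + 1"
  shows "\<exists>C E. \<forall>p::nat. prime p \<longrightarrow> E < p \<longrightarrow>
    real p powr (\<beta> * real CARD('n)) \<le> C * real p powr (2 * \<sigma> * (1 + \<beta>))"
proof -
  let ?d = "CARD('n)"
  have d: "1 \<le> real ?d" by (metis One_nat_def one_le_card_finite of_nat_1 of_nat_mono)
  have "0 \<le> \<beta>"
  proof -
    have "\<alpha> * 1 \<le> \<alpha> * (1 + \<beta>)" using \<alpha> \<beta> by (simp add: mult.commute)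
    then show ?thesis using \<alpha> by (simp only: mult_le_cancel_left_pos)
  qed
  obtain E :: nat where "0 < E" and E: "\<And>p. prime p \<Longrightarrow> E < p \<Longrightarrow>
    \<exists>K\<ge>1. \<exists>x :: int ^ 'n. E * K ^ CARD('n) \<le> p \<and> p < E * (2 * K) ^ CARD('n) \<and>
      (\<forall>i. 0 \<le> x $ i \<and> x $ i < int p) \<and>
      (\<forall>k. k \<noteq> 0 \<longrightarrow> (\<forall>i. \<bar>k $ i\<bar> \<le> int K) \<longrightarrow>
        \<not> int p dvd (\<Sum>i\<in>UNIV. k $ i * mpoly_eval (mpoly_pderiv i P) x))"
    using gradient_avoids_short_relations[OF P] by blast
  \<comment> \<open>Since \<open>E * (2 * K) ^ d\<close> exceeds \<open>p\<close>, this constant turns the separation \<open>\<rho>\<close> found below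
    into \<open>A * \<rho> ^ d \<ge> p powr - (d + 1)\<close>. It does not depend on \<open>p\<close>, and neither does the
    Frostman constant, so the estimate supplies one constant \<open>M\<close> for all \<open>p\<close>.\<close>
  define A where "A = (4 * real ?d) ^ ?d * (real E * 2 ^ ?d) ^ (?d - 1)"
  have "1 \<le> A"
  proof -
    have "1 \<le> real E" using \<open>0 < E\<close> by simp
    then have "1 * 1 \<le> real E * 2 ^ ?d" by (intro mult_mono) auto
    then have "1 \<le> real E * 2 ^ ?d" by (simp only: mult_1)
    moreover have "1 \<le> 4 * real ?d" using d by linarith
    ultimately have "1 * 1 \<le> A"
      unfolding A_def by (intro mult_mono one_le_power) (assumption | simp)+
    then show ?thesis by simp
  qed
  obtain M where M: "\<And>(\<mu> :: 'n torus measure) f. frostman \<alpha> (12 ^ ?d * A) \<mu> \<Longrightarrow> trig_polynomial f \<Longrightarrow>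
      L2_norm \<mu> (maximal_function P f) \<le> ennreal (M * sobolev_norm s f)"
    using est unfolding fractal_maximal_estimate_def by blast
  define C where "C = 4 * M\<^sup>2 * (8 * real ?d) powr \<sigma> * (12 * real ?d) powr \<alpha>"
  have "real p powr (\<beta> * real ?d) \<le> C * real p powr (2 * \<sigma> * (1 + \<beta>))" if p: "prime p" "E < p" for p :: nat
  proof -
    obtain K :: nat and a :: "int ^ 'n" where K: "K \<ge> 1" "E * K ^ ?d \<le> p" "p < E * (2 * K) ^ ?d"
      and a: "\<And>i. 0 \<le> a $ i \<and> a $ i < int p"
      and short: "\<And>k. k \<noteq> 0 \<Longrightarrow> (\<And>i. \<bar>k $ i\<bar> \<le> int K) \<Longrightarrow>
        \<not> int p dvd (\<Sum>i\<in>UNIV. k $ i * mpoly_eval (mpoly_pderiv i P) a)"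
      using E[OF p] by blast
    define v :: "int ^ 'n" where "v = (\<chi> i. mpoly_eval (mpoly_pderiv i P) a)"
    have v: "\<And>i. v $ i = mpoly_eval (mpoly_pderiv i P) a" by (simp add: v_def)
    have short_v: "\<And>k. k \<noteq> 0 \<Longrightarrow> (\<And>i. \<bar>k $ i\<bar> \<le> int K) \<Longrightarrow> \<not> int p dvd (\<Sum>i\<in>UNIV. k $ i * v $ i)"
      unfolding v by (rule short)
    have p0: "0 < p" and p1: "1 \<le> real p" using p by (simp_all add: prime_gt_0_nat Suc_leI)
    have "K ^ ?d \<le> E * K ^ ?d" using \<open>0 < E\<close> by simp
    then have Kp: "K ^ ?d \<le> p" using K(2) by (rule order_trans)
    \<comment> \<open>\<open>X\<close> is the size of the frequencies.\<close>
    define X where "X = real p powr (1 + \<beta>)"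
    have "0 < X" using p0 by (simp add: X_def)
    have X_alpha: "X powr \<alpha> = real p ^ (?d + 1)"
    proof -
      have "X powr \<alpha> = real p powr ((1 + \<beta>) * \<alpha>)" by (simp add: X_def powr_powr)
      also have "\<dots> = real p powr real (?d + 1)" by (simp only: \<beta> of_nat_add of_nat_1)
      also have "\<dots> = real p ^ (?d + 1)" using p0 by (intro powr_realpow) simp
      finally show ?thesis .
    qed
    define L where "L = nat \<lceil>real p powr \<beta>\<rceil>"
    have pb: "1 \<le> real p powr \<beta>" using p1 \<open>0 \<le> \<beta>\<close> by (rule ge_one_powr_ge_zero)
    have L: "real p powr \<beta> \<le> real L" "real L \<le> 2 * real p powr \<beta>"
      using pb unfolding L_def by linarith+
    have "0 < L" using L pb by (cases L) auto
    have X_eq: "X = real p * real p powr \<beta>" using p0 by (simp add: X_def powr_add)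
    have pL: "X \<le> real (p * L)" "real (p * L) \<le> 2 * X"
      using L p0 by (simp_all add: X_eq)
    \<comment> \<open>The side of the cubes on which the solution stays large, and the separation of their
      corners modulo \<open>\<int>\<^sup>d\<close>.\<close>
    define \<eta> where "\<eta> = 1 / (6 * real ?d * real (p * L))"
    define \<rho> where "\<rho> = real K ^ (?d - 1) / (4 * real ?d) / (real p)\<^sup>2"
    define y :: "int ^ 'n \<Rightarrow> real ^ 'n" where "y W = (\<chi> i. of_int (W $ i) / (real p)\<^sup>2)" for W
    define Y where "Y = y ` refocusing_points p v"
    define f where "f = (\<lambda>x. \<Sum>n\<in>progression p L a. character n x)"
    have "0 < real (p * L)" using p0 \<open>0 < L\<close> by simp
    then have "0 < \<eta>" using d by (simp add: \<eta>_def)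
    have "0 < \<rho>" using K p0 by (simp add: \<rho>_def)
    have eta_X: "\<eta> \<le> 1 / X"
    proof -
      have six: "1 \<le> 6 * real ?d" using d by linarith
      have "X \<le> real (p * L)" by (rule pL)
      also have "\<dots> = 1 * real (p * L)" by simp
      also have "\<dots> \<le> 6 * real ?d * real (p * L)" by (rule mult_right_mono[OF six]) simp
      finally show ?thesis unfolding \<eta>_def using \<open>0 < X\<close> by (intro frac_le) auto
    qed
    have "1 \<le> X" using p1 \<open>0 \<le> \<beta>\<close> unfolding X_def by (intro ge_one_powr_ge_zero) auto
    then have "\<eta> \<le> 1" using eta_X by (meson order_trans divide_le_eq_1 less_le_trans zero_less_one)
    have content: "\<eta> powr \<alpha> \<le> A * \<rho> ^ ?d"
    proof -
      have "\<eta> powr \<alpha> \<le> (1 / X) powr \<alpha>"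
        using \<open>0 < \<eta>\<close> eta_X \<alpha> by (intro powr_mono2) auto
      also have "\<dots> = 1 / real p ^ (?d + 1)"
        using \<open>0 < X\<close> by (simp add: powr_divide X_alpha)
      also have "\<dots> = real p ^ (?d - 1) / (real p)\<^sup>2 ^ ?d"
      proof -
        have "(?d - 1) + (?d + 1) = 2 * ?d" using one_le_card_finite[where 'a = 'n] by linarith
        then have "real p ^ (?d - 1) * real p ^ (?d + 1) = (real p)\<^sup>2 ^ ?d"
          by (simp only: flip: power_add power_mult)
        then show ?thesis using p0 by (simp add: field_simps)
      qed
      also have "\<dots> \<le> (real E * (2 * real K) ^ ?d) ^ (?d - 1) / (real p)\<^sup>2 ^ ?d"
      proof (intro divide_right_mono power_mono)
        have "real p \<le> real (E * (2 * K) ^ ?d)" using K by (simp only: of_nat_le_iff)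
        then show "real p \<le> real E * (2 * real K) ^ ?d" by simp
      qed auto
      also have "\<dots> = A * \<rho> ^ ?d"
      proof -
        have "(real K ^ ?d) ^ (?d - 1) = (real K ^ (?d - 1)) ^ ?d"
          by (simp add: mult.commute flip: power_mult)
        then show ?thesis
          using d by (simp add: A_def \<rho>_def power_mult_distrib power_divide)
      qed
      finally show ?thesis .
    qed
    have y_inj: "inj_on y (refocusing_points p v)"
      using p0 by (auto simp: inj_on_def y_def vec_eq_iff)
    have "frostman \<alpha> (12 ^ ?d * A) (cubes_measure (\<eta> powr (\<alpha> - real ?d)) \<eta> Y)"
    proof (rule frostman_cubes_measure)
      show "finite Y" by (simp add: Y_def finite_refocusing_points)
      fix z z' assume "z \<in> Y" "z' \<in> Y"
      then obtain W W' where W: "W \<in> refocusing_points p v" "W' \<in> refocusing_points p v" "z = y W" "z' = y W'"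
        by (auto simp: Y_def)
      show "\<exists>i. \<rho> \<le> \<bar>(z + m - z') $ i\<bar>" if "m \<in> int_lattice" "z + m \<noteq> z'" for m
      proof -
        obtain k where k: "m = of_int_vec k" using \<open>m \<in> int_lattice\<close> by (auto simp: int_lattice_def)
        have scaled: "(z + m - z') $ i = real_of_int ((W + (int p)\<^sup>2 *s k - W') $ i) / (real p)\<^sup>2" for i
          using p0 by (simp add: W y_def k of_int_vec_def field_simps)
        have "W + (int p)\<^sup>2 *s k \<noteq> W'"
        proof
          assume "W + (int p)\<^sup>2 *s k = W'"
          then have zero: "(W + (int p)\<^sup>2 *s k - W') $ i = 0" for i by simp
          have "z + m - z' = 0" by (simp only: vec_eq_iff scaled zero zero_index) simp
          then show False using that by simp
        qed
        then obtain i where "real K ^ (?d - 1) / (4 * real ?d) \<le> real_of_int \<bar>(W + (int p)\<^sup>2 *s k - W') $ i\<bar>"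
          using refocusing_points_separated[OF p(1) K(1) Kp short_v W(1,2)] by blast
        then have "\<rho> \<le> real_of_int \<bar>(W + (int p)\<^sup>2 *s k - W') $ i\<bar> / (real p)\<^sup>2"
          unfolding \<rho>_def by (rule divide_right_mono) simp
        also have "\<dots> = \<bar>(z + m - z') $ i\<bar>"
          unfolding scaled by simp
        finally show ?thesis by blast
      qed
      show "z = z'" if diff: "z - z' \<in> int_lattice"
      proof -
        obtain k where k: "z - z' = of_int_vec k" using diff unfolding int_lattice_def by blast
        have "W $ i = W' $ i" for i
        proof -
          have "real_of_int (W $ i) / (real p)\<^sup>2 - real_of_int (W' $ i) / (real p)\<^sup>2 = real_of_int (k $ i)"
            using arg_cong[OF k, of "\<lambda>x. x $ i"] by (simp add: W y_def of_int_vec_def)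
          then have "real_of_int (W $ i) - real_of_int (W' $ i) = real_of_int (k $ i) * (real p)\<^sup>2"
            using p0 by (simp add: field_simps)
          then have "real_of_int (W $ i - W' $ i) = real_of_int (k $ i * (int p)\<^sup>2)" by simp
          then have "W $ i - W' $ i = k $ i * (int p)\<^sup>2" by (simp only: of_int_eq_iff)
          then have "(int p)\<^sup>2 dvd W $ i - W' $ i" by simp
          then have "W $ i mod (int p)\<^sup>2 = W' $ i mod (int p)\<^sup>2" by (simp add: mod_eq_dvd_iff)
          moreover have "W $ i \<in> {0..<(int p)\<^sup>2}" "W' $ i \<in> {0..<(int p)\<^sup>2}"
            using W by (auto simp: refocusing_points_def)
          ultimately show ?thesis by simp
        qed
        then show ?thesis by (simp add: W y_def)
      qed
    qed (use \<open>0 < \<rho>\<close> \<open>0 < \<eta>\<close> \<open>\<eta> \<le> 1\<close> \<alpha> \<open>1 \<le> A\<close> content in auto)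
    then have "L2_norm (cubes_measure (\<eta> powr (\<alpha> - real ?d)) \<eta> Y) (maximal_function P f) \<le> ennreal (M * sobolev_norm s f)"
      unfolding f_def by (rule M) (intro trig_polynomial_sum_characters finite_progression)
    moreover have sob: "0 \<le> sobolev_norm s f"
      unfolding f_def sobolev_norm_sum_characters[OF finite_progression] by (simp add: sum_nonneg)
    ultimately have norm: "L2_norm (cubes_measure (\<eta> powr (\<alpha> - real ?d)) \<eta> Y) (maximal_function P f) \<le> ennreal (\<bar>M\<bar> * sobolev_norm s f)"
      by (meson abs_ge_self ennreal_leI mult_right_mono order_trans)
    have "(real L ^ ?d / 2)\<^sup>2 * (real (card Y) * (\<eta> powr (\<alpha> - real ?d) * \<eta> ^ ?d)) \<le> (\<bar>M\<bar> * sobolev_norm s f)\<^sup>2"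
    proof (rule L2_norm_cubes_measure_lower[OF _ _ _ _ _ _ norm])
      fix z u assume "z \<in> Y" and u: "u \<in> cbox z (z + vec \<eta>)"
      then obtain W where W: "W \<in> refocusing_points p v" "z = y W" by (auto simp: Y_def)
      have "0 \<le> u $ i - of_int (W $ i) / (real p)\<^sup>2 \<and> u $ i - of_int (W $ i) / (real p)\<^sup>2 \<le> \<eta>" for i
      proof -
        have "z $ i \<le> u $ i \<and> u $ i \<le> z $ i + \<eta>" using u by (simp add: mem_box_cart)
        then show ?thesis by (simp add: W y_def)
      qed
      then show "ennreal (real L ^ ?d / 2) \<le> maximal_function P f (torus_proj u)"
        unfolding f_def \<eta>_def by (intro maximal_function_large[OF p0 \<open>0 < L\<close> a v W(1)]) auto
    qed (use \<open>0 < \<eta>\<close> sob in \<open>auto simp: Y_def finite_refocusing_points\<close>)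
    moreover have "\<eta> powr (\<alpha> - real ?d) * \<eta> ^ ?d = \<eta> powr \<alpha>"
      using \<open>0 < \<eta>\<close> by (simp add: powr_diff powr_realpow)
    moreover have "(\<bar>M\<bar> * sobolev_norm s f)\<^sup>2 \<le> M\<^sup>2 * ((8 * real ?d) powr \<sigma> * X powr (2 * \<sigma>) * real L ^ ?d)"
    proof -
      have "(2 * real ?d * (real (p * L))\<^sup>2) powr \<sigma> \<le> (2 * real ?d * (2 * X)\<^sup>2) powr \<sigma>"
        using pL \<sigma> d by (intro powr_mono2 mult_left_mono power_mono) auto
      also have "2 * real ?d * (2 * X)\<^sup>2 = (8 * real ?d) * X powr 2"
        using \<open>0 < X\<close> by (simp add: powr_numeral)
      also have "\<dots> powr \<sigma> = (8 * real ?d) powr \<sigma> * X powr (2 * \<sigma>)"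
        by (simp add: powr_mult powr_powr)
      finally have "(2 * real ?d * (real (p * L))\<^sup>2) powr \<sigma> * real L ^ ?d
          \<le> (8 * real ?d) powr \<sigma> * X powr (2 * \<sigma>) * real L ^ ?d"
        by (intro mult_right_mono) auto
      then have "(sobolev_norm s f)\<^sup>2 \<le> (8 * real ?d) powr \<sigma> * X powr (2 * \<sigma>) * real L ^ ?d"
        using sobolev_norm_progression[OF p0 \<open>0 < L\<close> a \<sigma>] unfolding f_def by linarith
      then show ?thesis
        by (simp only: power_mult_distrib power2_abs) (intro mult_left_mono, auto)
    qed
    moreover have mass: "(1 / (12 * real ?d)) powr \<alpha> \<le> real (card Y) * \<eta> powr \<alpha>"
    proof -
      \<comment> \<open>The unit vectors have entries at most \<open>K\<close>, so they are no relations and \<open>v\<close> is nonzero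
        modulo \<open>p\<close>; hence there are at least \<open>p ^ (d + 1)\<close> refocusing points.\<close>
      obtain i\<^sub>0 :: 'n where True by blast
      have sum_axis: "(\<Sum>i\<in>UNIV. axis i\<^sub>0 1 $ i * v $ i) = v $ i\<^sub>0"
        by (simp add: axis_def if_distrib[of "\<lambda>x. x * _"] cong: if_cong)
      have "\<not> int p dvd (\<Sum>i\<in>UNIV. axis i\<^sub>0 1 $ i * v $ i)"
        using K(1) by (intro short_v) (auto simp: axis_def vec_eq_iff)
      then have "\<not> int p dvd v $ i\<^sub>0" by (simp only: sum_axis not_False_eq_True)
      then have "p ^ (?d + 1) \<le> card (refocusing_points p v)"
        by (rule card_refocusing_points[OF p(1)])
      then have "real (p ^ (?d + 1)) \<le> real (card Y)"
        unfolding Y_def card_image[OF y_inj] by (simp only: of_nat_le_iff)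
      then have "X powr \<alpha> * \<eta> powr \<alpha> \<le> real (card Y) * \<eta> powr \<alpha>"
        unfolding X_alpha by (intro mult_right_mono) auto
      moreover have "(1 / (12 * real ?d)) powr \<alpha> \<le> (X * \<eta>) powr \<alpha>"
      proof (rule powr_mono2)
        define N where "N = real (p * L)"
        have "N / (12 * real ?d * N) \<le> (2 * X) / (12 * real ?d * N)"
          using pL(2) \<open>0 < real (p * L)\<close> unfolding N_def by (intro divide_right_mono) auto
        then show "1 / (12 * real ?d) \<le> X * \<eta>"
          using \<open>0 < real (p * L)\<close> unfolding \<eta>_def N_def[symmetric] by (simp add: mult_ac)
      qed (use \<alpha> in auto)
      moreover have "(X * \<eta>) powr \<alpha> = X powr \<alpha> * \<eta> powr \<alpha>"
        using \<open>0 < X\<close> \<open>0 < \<eta>\<close> by (simp add: powr_mult)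
      ultimately show ?thesis by linarith
    qed
    ultimately have "(real L ^ ?d / 2)\<^sup>2 * (1 / (12 * real ?d)) powr \<alpha>
        \<le> M\<^sup>2 * ((8 * real ?d) powr \<sigma> * X powr (2 * \<sigma>) * real L ^ ?d)"
      by (smt (verit) mult_left_mono zero_le_power2)
    then have "(real L ^ ?d) * (real L ^ ?d * (1 / (12 * real ?d)) powr \<alpha>)
        \<le> (real L ^ ?d) * (4 * M\<^sup>2 * (8 * real ?d) powr \<sigma> * X powr (2 * \<sigma>))"
      by (simp add: power2_eq_square mult_ac)
    then have "real L ^ ?d * (1 / (12 * real ?d)) powr \<alpha> \<le> 4 * M\<^sup>2 * (8 * real ?d) powr \<sigma> * X powr (2 * \<sigma>)"
      by (rule mult_left_le_imp_le) (use \<open>0 < L\<close> in simp)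
    then have "real L ^ ?d \<le> C * X powr (2 * \<sigma>)"
      using d by (simp add: C_def powr_divide divide_le_eq mult_ac)
    moreover have "real p powr (\<beta> * real ?d) \<le> real L ^ ?d"
    proof -
      have "(real p powr \<beta>) ^ ?d \<le> real L ^ ?d" using L by (intro power_mono) auto
      then show ?thesis using p0 by (simp add: powr_powr flip: powr_realpow)
    qed
    ultimately show ?thesis by (simp add: X_def powr_powr mult_ac)
  qed
  then show ?thesis by blast
qed

lemma exponent_le_if_prime_powers_bounded:
  fixes a b C :: real and E :: nat
  assumes "\<And>p::nat. prime p \<Longrightarrow> E < p \<Longrightarrow> real p powr a \<le> C * real p powr b"
  shows "a \<le> b"
proof (rule ccontr)
  assume "\<not> a \<le> b"
  then have "0 < a - b" by simp
  obtain p :: nat where p: "prime p" "E + nat \<lceil>\<bar>C\<bar> powr (1 / (a - b))\<rceil> < p"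
    using bigger_prime by blast
  then have "0 < p" by simp
  have "\<bar>C\<bar> = (\<bar>C\<bar> powr (1 / (a - b))) powr (a - b)"
    using \<open>0 < a - b\<close> by (simp add: powr_powr)
  also have "\<dots> < real p powr (a - b)"
  proof (rule powr_less_mono2)
    show "\<bar>C\<bar> powr (1 / (a - b)) < real p" using p by linarith
  qed (use \<open>0 < a - b\<close> in auto)
  finally have "\<bar>C\<bar> * real p powr b < real p powr (a - b) * real p powr b"
    using \<open>0 < p\<close> by (intro mult_strict_right_mono) auto
  also have "\<dots> = real p powr a" by (simp flip: powr_add)
  also have "\<dots> \<le> C * real p powr b" using p by (intro assms) auto
  also have "\<dots> \<le> \<bar>C\<bar> * real p powr b" by (intro mult_right_mono) auto
  finally show False by simp
qed

theorem theorem1p2: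
  fixes P :: "'n::finite int_mpoly" and \<alpha> :: real
  assumes "0 < \<alpha>" and "\<alpha> < real CARD('n)"
    and "mpoly_degree P \<ge> 2" and "nonsingular P"
  shows "critical_exponent P \<alpha> \<ge>
    ereal (real CARD('n) / (2 * (real CARD('n) + 1)) * (real CARD('n) + 1 - \<alpha>))"
  unfolding critical_exponent_def
proof (rule INF_greatest)
  let ?d = "real CARD('n)"
  fix s assume "s \<in> {s. fractal_maximal_estimate P \<alpha> s}"
  then have est: "fractal_maximal_estimate P \<alpha> s" by simp
  define \<beta> where "\<beta> = (?d + 1 - \<alpha>) / \<alpha>"
  have \<beta>: "(1 + \<beta>) * \<alpha> = ?d + 1" "\<beta> * \<alpha> = ?d + 1 - \<alpha>"
    using assms(1) by (simp_all add: \<beta>_def field_simps)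
  \<comment> \<open>The bound sought is positive, so it suffices to bound \<open>max s 0\<close>, for which the estimates of
    the Sobolev norm are monotone in the frequency.\<close>
  obtain C E where "\<And>p::nat. prime p \<Longrightarrow> E < p \<Longrightarrow>
      real p powr (\<beta> * ?d) \<le> C * real p powr (2 * max s 0 * (1 + \<beta>))"
    using estimate_bounds_prime_powers[OF assms est max.cobounded1 max.cobounded2 \<beta>(1)] by blast
  then have "\<beta> * ?d \<le> 2 * max s 0 * (1 + \<beta>)"
    by (rule exponent_le_if_prime_powers_bounded)
  then have "(\<beta> * ?d) * \<alpha> \<le> (2 * max s 0 * (1 + \<beta>)) * \<alpha>"
    using assms(1) by (intro mult_right_mono) auto
  then have "?d * (\<beta> * \<alpha>) \<le> 2 * max s 0 * ((1 + \<beta>) * \<alpha>)"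
    by (simp only: mult_ac)
  then have "?d * (?d + 1 - \<alpha>) \<le> max s 0 * (2 * (?d + 1))"
    unfolding \<beta> by (simp only: mult_ac)
  then have "?d / (2 * (?d + 1)) * (?d + 1 - \<alpha>) \<le> max s 0"
    by (simp add: divide_le_eq)
  moreover have "0 < ?d / (2 * (?d + 1)) * (?d + 1 - \<alpha>)"
    using assms(2) by (intro mult_pos_pos divide_pos_pos) auto
  ultimately show "ereal (?d / (2 * (?d + 1)) * (?d + 1 - \<alpha>)) \<le> ereal s"
    by (simp add: max_def split: if_splits)
qed

end
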